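(* Let $\gamma>1$, let $A_0,A_1\in\mathbb{M}^3$, define $A_\infty(t)=A_0+tA_1$, and assume that $$\lim_{t\to\infty}\det A_\infty(t)=+\infty.$$ Let $d\in\{1,2,3\}$ be the degree of the polynomial $t\mapsto\det A_\infty(t)$, and let $a\in\{-1,0,1\}$ be the integer such that $\|A_\infty(t)^{-1}\|\sim t^a$ for $t\gg1$. Consider the equation $$(\ast)\qquad A''(t)=(\det A(t))^{1-\gamma}A(t)^{-\top}.$$ (i) If $a\neq1$ and $\mu:=d(\gamma-1)-a-2>0$, then $(\ast)$ has a unique global solution $A\in C(\mathbb{R},\mathrm{GL}^+(3,\mathbb{R}))\cap C^\infty(\mathbb{R},\mathbb{M}^3)$ with $$\lim_{t\to\infty}\|A(t)-A_\infty(t)\|=0.$$ Moreover, the solution satisfies the decay estimates $$\|A^{(k)}(t)-A_\infty^{(k)}(t)\|\lesssim t^{-\mu-k},\quad t\gg1,\quad k=0,1,2.$$ (ii) If $a=d=1$ and $\gamma>5$, then $(\ast)$ has a unique global solution $A\in C(\mathbb{R},\mathrm{GL}^+(3,\mathbb{R}))\cap C^\infty(\mathbb{R},\mathbb{M}^3)$ with $$\lim_{t\to\infty}t\|A(t)-A_\infty(t)\|=0.$$ Moreover, the solution satisfies the decay estimates $$\|A^{(k)}(t)-A_\infty^{(k)}(t)\|\lesssim t^{4-\gamma-k},\quad t\gg1,\quad k=0,1,2.$$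
   Context: $\mathbb{M}^3$ is the space of real $3\times3$ matrices with operator norm $\|\cdot\|$, $\mathrm{GL}^+(3,\mathbb{R})=\{A\in\mathbb{M}^3:\det A>0\}$, $A^{-\top}=(A^{-1})^\top$, and $A^{(k)}$ denotes the $k$-th derivative in $t$. For nonnegative functions of $t$, $x\lesssim y$ for $t\gg1$ means there are constants $c>0$, $T>0$ with $x(t)\le c\,y(t)$ for $t\ge T$; $x\sim y$ means $x\lesssim y$ and $y\lesssim x$. It is known that under the assumption $\lim_{t\to\infty}\det A_\infty(t)=+\infty$ one has $A_\infty(t)\in\mathrm{GL}^+(3,\mathbb{R})$ for $t\gg1$, and the integer $a$ exists, with $a=-1$ if $d=3$, $a=0$ if $d=2$, and $a\in\{0,1\}$ if $d=1$. *)

theory Defs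
  imports "HOL-Analysis.Analysis" "HOL-Computational_Algebra.Polynomial"
    "HOL-Library.Landau_Symbols"
begin

(* The norm class instance on real^3^3 is the Frobenius norm, so the operator norm
   has to be taken explicitly. *)
definition opnorm :: "real^3^3 \<Rightarrow> real" where
  "opnorm M = onorm (\<lambda>x. M *v x)"

definition GL_pos :: "(real^3^3) set" where
  "GL_pos = {M. det M > 0}"

definition nth_vderiv :: "nat \<Rightarrow> (real \<Rightarrow> 'a::real_normed_vector) \<Rightarrow> real \<Rightarrow> 'a" where
  "nth_vderiv k f = ((\<lambda>g t. vector_derivative g (at t)) ^^ k) f"

(* vector_derivative is an arbitrary value where no derivative exists; since every iterate
   is required to be differentiable everywhere, all of them are genuine derivatives here. *)
definition smooth :: "(real \<Rightarrow> 'a::real_normed_vector) \<Rightarrow> bool" where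
  "smooth f \<longleftrightarrow> (\<forall>k t. nth_vderiv k f differentiable (at t))"

definition A_infty :: "real^3^3 \<Rightarrow> real^3^3 \<Rightarrow> real \<Rightarrow> real^3^3" where
  "A_infty A0 A1 t = A0 + t *\<^sub>R A1"

definition global_solution :: "real \<Rightarrow> (real \<Rightarrow> real^3^3) \<Rightarrow> bool" where
  "global_solution \<gamma> A \<longleftrightarrow>
     continuous_on UNIV A \<and> range A \<subseteq> GL_pos \<and> smooth A \<and>
     (\<forall>t. nth_vderiv 2 A t =
        (det (A t) powr (1 - \<gamma>)) *\<^sub>R transpose (matrix_inv (A t)))"

end

theory Submission
  imports Defs
begin

text \<open>
  The equation is A'' = F (A) with F (A) = det(A)^(1 - \<gamma>) A^(-T) = det(A)^(-\<gamma>) cof A, and the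
  solution is sought near the free motion M (t) = A0 + t A1, with u = A - M the unknown.

  Near infinity the problem is perturbative.  The force is equivariant, F (M X) = det(M)^(1 - \<gamma>)
  M^(-T) F (X), so with M + u = M (1 + M^(-1) u) everything reduces to a neighbourhood of the
  identity as soon as M^(-1) u is small (force_relative_perturbation).  If det M grows like t^d
  and the inverse like t^a, this gives norm F (M + u) of order t^(-\<mu> - 2) and a Lipschitz constant
  of order t^(a - \<mu> - 2).  Smallness of M^(-1) u needs u = o(1) for a \<le> 0 and u = o(1/t) for a = 1;
  with b = max a 0 both cases read t^b u = o(1), and both hypotheses on the parameters read \<mu> > b.
  Integrating u'' = F (M + u) twice from infinity produces u of order t^(-\<mu>), which is consistent
  exactly when \<mu> > b, and this is also the decay rate that is claimed.

  The problem u'' = G (t, u) with u vanishing at infinity is solved on the whole line at once.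
  If \<kappa> is the Lipschitz bound of G and t \<kappa> (t) is integrable at infinity, there is a positive convex
  function w on the line, bounded near infinity, with w'' \<ge> 2 \<kappa> w; in the norm weighted
  by w the integral operator contracts by 1/2 (second_order_solution_from_infinity), and the
  same weight yields uniqueness (second_order_unique_from_infinity).  After cutting off the force
  away from M this provides a solution for large times.

  Global existence comes from the energy norm(A')^2 / 2 + det(A)^(1 - \<gamma>) / (\<gamma> - 1), where norm is
  the Euclidean norm of matrices.  It is conserved because the derivative of det along A is
  the inner product of cof A with A'.  Hence the speed is bounded and, as the potential blows up
  when the determinant tends to 0, the determinant stays away from 0
  (extend_solution_to_past).  The equation is then solved backwards with
  the force cut off at small determinants and outside a growing ball; the energy shows that the
  solution never feels the cutoffs.  The backward problem is again posed with data at infinity,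
  for the difference to the solution already found.  Smoothness follows by bootstrapping.
\<close>

section \<open>Antiderivatives normalised at infinity\<close>

lemma continuous_has_antiderivative:
  fixes f :: "real \<Rightarrow> 'a::banach"
  assumes cont: "continuous_on UNIV f"
  shows "\<exists>u. \<forall>t. (u has_vector_derivative f t) (at t)"
proof -
  define u where "u t = integral {0..t} f - integral {t..0} f" for t
  have "(u has_vector_derivative f t) (at t)" for t
  proof -
    define a where "a = - \<bar>t\<bar> - 1"
    define b where "b = \<bar>t\<bar> + 1"
    have t: "t \<in> {a<..<b}" and a: "a < 0" and b: "0 < b" unfolding a_def b_def by auto
    have cab: "continuous_on {c..e} f" for c e
      using cont continuous_on_subset by blast
    have int: "f integrable_on {c..e}" for c e
      by (intro integrable_continuous_interval cab)
    have eq: "integral {a..s} f - integral {a..0} f = u s" if "s \<in> {a<..<b}" for s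
    proof (cases "s \<ge> 0")
      case True
      have "integral {a..0} f + integral {0..s} f = integral {a..s} f"
        by (rule Henstock_Kurzweil_Integration.integral_combine) (use a True int in auto)
      moreover have "integral {s..0} f = 0"
        using True by (cases "s = 0") auto
      ultimately show ?thesis by (simp add: u_def algebra_simps)
    next
      case False
      have "integral {a..s} f + integral {s..0} f = integral {a..0} f"
        by (rule Henstock_Kurzweil_Integration.integral_combine) (use that False int in auto)
      moreover have "integral {0..s} f = 0"
        using False by auto
      ultimately show ?thesis by (simp add: u_def algebra_simps)
    qed
    have "((\<lambda>s. integral {a..s} f) has_vector_derivative f t) (at t within {a..b})"
      by (rule integral_has_vector_derivative[OF cab]) (use t in auto)
    then have "((\<lambda>s. integral {a..s} f) has_vector_derivative f t) (at t)"
      using t at_within_Icc_at[of a t b] by auto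
    then have "((\<lambda>s. integral {a..s} f - integral {a..0} f) has_vector_derivative f t - 0) (at t)"
      by (intro derivative_intros) auto
    then have "((\<lambda>s. integral {a..s} f - integral {a..0} f) has_vector_derivative f t) (at t)"
      by simp
    then show ?thesis
      by (rule has_vector_derivative_transform_within_open[OF _ open_greaterThanLessThan t eq])
  qed
  then show ?thesis by blast
qed

text \<open>
  The mean value inequality in comparison form. A majorant is always presented below as the
  derivative of a scalar function, so that no improper integral ever has to be formed: the
  tail integral of the majorant is the distance of that function from its limit.
\<close>
lemma vector_deriv_bound:
  fixes u :: "real \<Rightarrow> 'a::real_normed_vector"
  assumes u: "\<And>t. t \<ge> T \<Longrightarrow> (u has_vector_derivative u' t) (at t)"
    and phi: "\<And>t. t \<ge> T \<Longrightarrow> (\<phi> has_real_derivative \<phi>' t) (at t)"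
    and le: "\<And>t. t \<ge> T \<Longrightarrow> norm (u' t) \<le> \<phi>' t"
    and ts: "T \<le> t" "t \<le> s"
  shows "norm (u s - u t) \<le> \<phi> s - \<phi> t"
proof (cases "t = s")
  case False
  then have "t < s" using ts by simp
  then show ?thesis
  proof (rule differentiable_bound_general[where f'=u' and \<phi>'=\<phi>'])
    show "continuous_on {t..s} u"
      by (intro continuous_at_imp_continuous_on ballI has_vector_derivative_continuous[OF u])
         (use ts in auto)
    show "continuous_on {t..s} \<phi>"
      by (intro continuous_at_imp_continuous_on ballI DERIV_isCont[OF phi]) (use ts in auto)
  qed (use ts u phi le in \<open>auto simp: has_real_derivative_iff_has_vector_derivative\<close>)
qed simp

lemma norm_le_from_infinity:
  fixes u :: "real \<Rightarrow> 'a::real_normed_vector"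
  assumes u: "\<And>t. t \<ge> T \<Longrightarrow> (u has_vector_derivative u' t) (at t)"
    and phi: "\<And>t. t \<ge> T \<Longrightarrow> (\<phi> has_real_derivative \<phi>' t) (at t)"
    and le: "\<And>t. t \<ge> T \<Longrightarrow> norm (u' t) \<le> \<phi>' t"
    and u0: "(u \<longlongrightarrow> 0) at_top" and phiL: "(\<phi> \<longlongrightarrow> L) at_top"
    and t: "t \<ge> T"
  shows "norm (u t) \<le> L - \<phi> t"
proof -
  have "((\<lambda>s. norm (u s - u t)) \<longlongrightarrow> norm (0 - u t)) at_top"
    by (intro tendsto_intros u0)
  moreover have "((\<lambda>s. \<phi> s - \<phi> t) \<longlongrightarrow> L - \<phi> t) at_top"
    by (intro tendsto_intros phiL)
  moreover have "\<forall>\<^sub>F s in at_top. norm (u s - u t) \<le> \<phi> s - \<phi> t"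
    using eventually_ge_at_top[of t]
    by eventually_elim (rule vector_deriv_bound[OF u phi le t])
  ultimately have "norm (0 - u t) \<le> L - \<phi> t"
    by (intro tendsto_le[OF trivial_limit_at_top_linorder]) auto
  then show ?thesis by simp
qed

text \<open>
  Integrating twice from infinity reverses the sign once and restores it the second time: a
  convex majorant that decreases to its limit dominates every function whose second derivative
  it dominates, provided both vanish at infinity to first order.
\<close>
lemma norm_le_from_infinity2:
  fixes u :: "real \<Rightarrow> 'a::real_normed_vector"
  assumes u: "\<And>t. t \<ge> T \<Longrightarrow> (u has_vector_derivative u' t) (at t)"
    and u': "\<And>t. t \<ge> T \<Longrightarrow> (u' has_vector_derivative u'' t) (at t)"
    and phi: "\<And>t. t \<ge> T \<Longrightarrow> (\<phi> has_real_derivative \<phi>' t) (at t)"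
    and phi': "\<And>t. t \<ge> T \<Longrightarrow> (\<phi>' has_real_derivative \<phi>'' t) (at t)"
    and le: "\<And>t. t \<ge> T \<Longrightarrow> norm (u'' t) \<le> \<phi>'' t"
    and lim: "(u \<longlongrightarrow> 0) at_top" "(u' \<longlongrightarrow> 0) at_top" "(\<phi> \<longlongrightarrow> L) at_top" "(\<phi>' \<longlongrightarrow> 0) at_top"
    and t: "t \<ge> T"
  shows "norm (u' t) \<le> - \<phi>' t" and "norm (u t) \<le> \<phi> t - L"
proof -
  have 1: "norm (u' s) \<le> - \<phi>' s" if "s \<ge> T" for s
    using norm_le_from_infinity[OF u' phi' le lim(2,4) that] by simp
  then show "norm (u' t) \<le> - \<phi>' t" using t by blast
  have "norm (u t) \<le> - L - - \<phi> t"
  proof (rule norm_le_from_infinity[OF u _ 1 lim(1) _ t])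
    show "((\<lambda>t. - \<phi> t) has_real_derivative - \<phi>' s) (at s)" if "s \<ge> T" for s
      using phi[OF that] by (rule DERIV_minus)
    show "((\<lambda>t. - \<phi> t) \<longlongrightarrow> - L) at_top" by (intro tendsto_minus lim)
  qed
  then show "norm (u t) \<le> \<phi> t - L" by simp
qed

text \<open>
  A majorant with a finite limit makes any antiderivative satisfy the Cauchy criterion at
  infinity, so it has a limit, which can be subtracted.  The majorant is needed only near
  infinity, while the antiderivative lives on the whole line.
\<close>
lemma antiderivative_vanishing_at_infinity:
  fixes f :: "real \<Rightarrow> 'a::banach"
  assumes cont: "continuous_on UNIV f"
    and phi: "\<And>t. t \<ge> T \<Longrightarrow> (\<phi> has_real_derivative \<phi>' t) (at t)"
    and le: "\<And>t. t \<ge> T \<Longrightarrow> norm (f t) \<le> \<phi>' t"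
    and L: "(\<phi> \<longlongrightarrow> L) at_top"
  shows "\<exists>u. (\<forall>t. (u has_vector_derivative f t) (at t)) \<and> (u \<longlongrightarrow> 0) at_top"
proof -
  obtain v where v: "\<And>t. (v has_vector_derivative f t) (at t)"
    using continuous_has_antiderivative[OF cont] by blast
  have bound: "norm (v s - v t) \<le> \<phi> s - \<phi> t" if "T \<le> t" "t \<le> s" for s t
    by (rule vector_deriv_bound[OF v phi le that])
  have "\<exists>l. (v \<longlongrightarrow> l) at_top"
  proof -
    have "Cauchy (\<lambda>n. v (real n))"
    proof (rule CauchyI)
      fix e :: real assume "e > 0"
      then have "\<forall>\<^sub>F t in at_top. dist (\<phi> t) L < e / 2"
        using L by (intro tendstoD) auto
      then obtain N where N: "\<And>t. t \<ge> N \<Longrightarrow> dist (\<phi> t) L < e / 2"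
        by (auto simp: eventually_at_top_linorder)
      have *: "norm (v s - v t) < e" if "s \<ge> max N T" "t \<ge> s" for s t
      proof -
        have "\<bar>\<phi> s - L\<bar> < e / 2" "\<bar>\<phi> t - L\<bar> < e / 2"
          using N[of s] N[of t] that by (simp_all add: dist_real_def)
        moreover have "norm (v t - v s) \<le> \<phi> t - \<phi> s" using bound[of s t] that by simp
        ultimately have "norm (v t - v s) < e" by linarith
        then show ?thesis by (simp only: norm_minus_commute)
      qed
      obtain M :: nat where M: "real M \<ge> max N T" using real_arch_simple by blast
      have "norm (v (real m) - v (real n)) < e" if "m \<ge> M" "n \<ge> M" for m n
        using *[of "real m" "real n"] *[of "real n" "real m"] M that
        by (cases "m \<le> n") (simp_all add: norm_minus_commute)
      then show "\<exists>M. \<forall>m\<ge>M. \<forall>n\<ge>M. norm (v (real m) - v (real n)) < e" by blast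
    qed
    then obtain l where l: "(\<lambda>n. v (real n)) \<longlonglongrightarrow> l"
      using Cauchy_convergent convergent_def by blast
    have vl: "norm (v t - l) \<le> L - \<phi> t" if t: "t \<ge> T" for t
    proof -
      have 1: "(\<lambda>n. norm (v t - v (real n))) \<longlonglongrightarrow> norm (v t - l)"
        by (intro tendsto_norm tendsto_diff tendsto_const l)
      have 2: "(\<lambda>n. \<phi> (real n) - \<phi> t) \<longlonglongrightarrow> L - \<phi> t"
        by (intro tendsto_diff tendsto_const filterlim_compose[OF L filterlim_real_sequentially])
      have 3: "\<forall>\<^sub>F n in sequentially. norm (v t - v (real n)) \<le> \<phi> (real n) - \<phi> t"
        using eventually_ge_at_top[of "nat \<lceil>t\<rceil>"]
      proof eventually_elim
        case (elim n)
        then have "t \<le> real n" by linarith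
        then show ?case using bound[OF t, of "real n"] by (simp add: norm_minus_commute)
      qed
      show ?thesis by (rule tendsto_le[OF sequentially_bot 2 1 3])
    qed
    have 1: "((\<lambda>t. L - \<phi> t) \<longlongrightarrow> 0) at_top"
      using tendsto_diff[OF tendsto_const[of L] L] by simp
    have "\<forall>\<^sub>F t in at_top. norm (v t - l) \<le> L - \<phi> t"
      using eventually_ge_at_top[of T] by eventually_elim (rule vl)
    then have "((\<lambda>t. v t - l) \<longlongrightarrow> 0) at_top"
      by (rule Lim_null_comparison[OF _ 1])
    then have "(v \<longlongrightarrow> l) at_top" by (rule LIM_zero_cancel)
    then show ?thesis ..
  qed
  then obtain l where l: "(v \<longlongrightarrow> l) at_top" by blast
  have "((\<lambda>t. v t - l) has_vector_derivative f t) (at t)" for t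
    using has_vector_derivative_diff[OF v[of t] has_vector_derivative_const[of l]] by simp
  moreover have "((\<lambda>t. v t - l) \<longlongrightarrow> 0) at_top" by (rule LIM_zero[OF l])
  ultimately show ?thesis by blast
qed

lemma second_antiderivative_vanishing_at_infinity:
  fixes f :: "real \<Rightarrow> 'a::banach"
  assumes cont: "continuous_on UNIV f"
    and phi: "\<And>t. t \<ge> T \<Longrightarrow> (\<phi> has_real_derivative \<phi>' t) (at t)"
    and phi': "\<And>t. t \<ge> T \<Longrightarrow> (\<phi>' has_real_derivative \<phi>'' t) (at t)"
    and le: "\<And>t. t \<ge> T \<Longrightarrow> norm (f t) \<le> \<phi>'' t"
    and lim: "(\<phi> \<longlongrightarrow> L) at_top" "(\<phi>' \<longlongrightarrow> 0) at_top"
  shows "\<exists>u u'. (\<forall>t. (u has_vector_derivative u' t) (at t)) \<and>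
    (\<forall>t. (u' has_vector_derivative f t) (at t)) \<and> (u \<longlongrightarrow> 0) at_top \<and> (u' \<longlongrightarrow> 0) at_top"
proof -
  obtain u' where u': "\<And>t. (u' has_vector_derivative f t) (at t)" "(u' \<longlongrightarrow> 0) at_top"
    using antiderivative_vanishing_at_infinity[OF cont phi' le lim(2)] by blast
  have bound: "norm (u' t) \<le> - \<phi>' t" if "t \<ge> T" for t
    using norm_le_from_infinity[OF u'(1) phi' le u'(2) lim(2) that] by simp
  have "\<exists>u. (\<forall>t. (u has_vector_derivative u' t) (at t)) \<and> (u \<longlongrightarrow> 0) at_top"
  proof (rule antiderivative_vanishing_at_infinity[where \<phi>'="\<lambda>t. - \<phi>' t"])
    show "continuous_on UNIV u'"
      using u'(1) by (auto intro!: continuous_at_imp_continuous_on has_vector_derivative_continuous)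
    show "((\<lambda>t. - \<phi> t) has_real_derivative - \<phi>' t) (at t)" if "t \<ge> T" for t
      using phi[OF that] by (rule DERIV_minus)
    show "((\<lambda>t. - \<phi> t) \<longlongrightarrow> - L) at_top" by (intro tendsto_intros lim)
  qed (use bound in auto)
  then show ?thesis using u' by blast
qed

text \<open>
  Decay of the function alone fixes the derivative: the second antiderivative normalised at
  infinity differs from the function by an affine map, and an affine map that vanishes at
  infinity is zero.
\<close>
lemma deriv_tendsto_0_of_second_deriv_bound:
  fixes u :: "real \<Rightarrow> 'a::banach"
  assumes u: "\<And>t. (u has_vector_derivative u' t) (at t)"
    and u': "\<And>t. (u' has_vector_derivative u'' t) (at t)"
    and cont: "continuous_on UNIV u''"
    and phi: "\<And>t. t \<ge> T \<Longrightarrow> (\<phi> has_real_derivative \<phi>' t) (at t)"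
    and phi': "\<And>t. t \<ge> T \<Longrightarrow> (\<phi>' has_real_derivative \<phi>'' t) (at t)"
    and le: "\<And>t. t \<ge> T \<Longrightarrow> norm (u'' t) \<le> \<phi>'' t"
    and lim: "(u \<longlongrightarrow> 0) at_top" "(\<phi> \<longlongrightarrow> L) at_top" "(\<phi>' \<longlongrightarrow> 0) at_top"
  shows "(u' \<longlongrightarrow> 0) at_top"
proof -
  obtain v v' where v: "\<And>t. (v has_vector_derivative v' t) (at t)"
      "\<And>t. (v' has_vector_derivative u'' t) (at t)" "(v \<longlongrightarrow> 0) at_top" "(v' \<longlongrightarrow> 0) at_top"
    using second_antiderivative_vanishing_at_infinity[OF cont phi phi' le lim(2,3)] by blast
  have "((\<lambda>t. u' t - v' t) has_vector_derivative 0) (at t)" for t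
    using has_vector_derivative_diff[OF u'[of t] v(2)[of t]] by simp
  then obtain q where q: "\<And>t. u' t - v' t = q"
    using has_vector_derivative_zero_constant[of UNIV "\<lambda>t. u' t - v' t"] by auto
  have "((\<lambda>t. u t - v t - t *\<^sub>R q) has_vector_derivative 0) (at t)" for t
  proof -
    have "((\<lambda>t. t *\<^sub>R q) has_vector_derivative q) (at t)"
      using has_vector_derivative_scaleR[OF DERIV_ident has_vector_derivative_const[of q]] by simp
    from has_vector_derivative_diff[OF has_vector_derivative_diff[OF u v(1)] this]
    show ?thesis using q[of t] by simp
  qed
  then obtain p where p: "\<And>t. u t - v t - t *\<^sub>R q = p"
    using has_vector_derivative_zero_constant[of UNIV "\<lambda>t. u t - v t - t *\<^sub>R q"] by auto
  have 0: "((\<lambda>t. u t - v t) \<longlongrightarrow> 0 - 0) at_top" by (intro tendsto_intros lim v)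
  have "filterlim (\<lambda>t::real. t + 1) at_top at_top"
    by (intro filterlim_at_top_mono[OF filterlim_ident] eventuallyI) auto
  from filterlim_compose[OF 0 this]
  have 1: "((\<lambda>t. u (t + 1) - v (t + 1)) \<longlongrightarrow> 0) at_top" by simp
  have "((\<lambda>t. (u (t + 1) - v (t + 1)) - (u t - v t)) \<longlongrightarrow> 0 - (0 - 0)) at_top"
    by (intro tendsto_diff[OF 1 0])
  moreover have "(u (t + 1) - v (t + 1)) - (u t - v t) = q" for t
    using p[of t] p[of "t + 1"] by (simp add: algebra_simps)
  ultimately have "((\<lambda>t::real. q) \<longlongrightarrow> 0) at_top" by simp
  then have "q = 0"
    using tendsto_unique[OF trivial_limit_at_top_linorder tendsto_const] by blast
  with q have "u' = v'" by auto
  with v(4) show ?thesis by simp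
qed

section \<open>Second-order equations with data at infinity\<close>

text \<open>
  The majorant for accelerations of order t^(-\<sigma> - 2).  The positivity of \<sigma> makes it vanish at
  infinity, so that such an acceleration can be integrated twice from there.
\<close>
lemma powr_weight:
  fixes \<sigma> K :: real
  assumes "\<sigma> > 0"
  shows "t > 0 \<Longrightarrow> ((\<lambda>t. K / (\<sigma> * (\<sigma> + 1)) * t powr (- \<sigma>)) has_real_derivative
      - (K / (\<sigma> + 1)) * t powr (- \<sigma> - 1)) (at t)"
    and "t > 0 \<Longrightarrow> ((\<lambda>t. - (K / (\<sigma> + 1)) * t powr (- \<sigma> - 1)) has_real_derivative
      K * t powr (- \<sigma> - 2)) (at t)"
    and "((\<lambda>t. K / (\<sigma> * (\<sigma> + 1)) * t powr (- \<sigma>)) \<longlongrightarrow> 0) at_top"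
    and "((\<lambda>t. - (K / (\<sigma> + 1)) * t powr (- \<sigma> - 1)) \<longlongrightarrow> 0) at_top"
proof -
  have tend: "((\<lambda>t. C * t powr s) \<longlongrightarrow> 0) at_top" if "s < 0" for s C :: real
    using tendsto_mult_right_zero[OF tendsto_neg_powr[OF that filterlim_ident], of C] by simp
  show "((\<lambda>t. K / (\<sigma> * (\<sigma> + 1)) * t powr (- \<sigma>)) \<longlongrightarrow> 0) at_top"
    "((\<lambda>t. - (K / (\<sigma> + 1)) * t powr (- \<sigma> - 1)) \<longlongrightarrow> 0) at_top"
    using assms by (intro tend; simp)+
  assume t: "t > 0"
  have d: "((\<lambda>t. C * t powr s) has_real_derivative C * s * t powr (s - 1)) (at t)" for s C
    using DERIV_cmult[OF has_real_derivative_powr[OF t, of s], of C] by (simp add: algebra_simps)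
  show "((\<lambda>t. K / (\<sigma> * (\<sigma> + 1)) * t powr (- \<sigma>)) has_real_derivative
      - (K / (\<sigma> + 1)) * t powr (- \<sigma> - 1)) (at t)"
  proof (rule DERIV_cong[OF d])
    have "K / (\<sigma> * (\<sigma> + 1)) * - \<sigma> = - (K / (\<sigma> + 1))" using assms by (simp add: divide_simps)
    then show "K / (\<sigma> * (\<sigma> + 1)) * - \<sigma> * t powr (- \<sigma> - 1) = - (K / (\<sigma> + 1)) * t powr (- \<sigma> - 1)"
      by (simp only:)
  qed
  show "((\<lambda>t. - (K / (\<sigma> + 1)) * t powr (- \<sigma> - 1)) has_real_derivative
      K * t powr (- \<sigma> - 2)) (at t)"
  proof (rule DERIV_cong[OF d])
    have "- \<sigma> - 1 - 1 = - \<sigma> - 2" by simp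
    moreover have "- (K / (\<sigma> + 1)) * (- \<sigma> - 1) = K" using assms by (simp add: field_simps)
    ultimately show "- (K / (\<sigma> + 1)) * (- \<sigma> - 1) * t powr (- \<sigma> - 1 - 1) = K * t powr (- \<sigma> - 2)"
      by (simp only:)
  qed
qed

text \<open>
  The weight for which the problem with data at infinity becomes a contraction.  If m is the
  second antiderivative of the Lipschitz bound that vanishes at infinity to first order, then
  w = exp (2 m) satisfies w'' = (2 m'' + 4 m'^2) w, which is at least twice the Lipschitz bound
  times w on the whole real line.  Weighting by w hence gives contraction factor 1/2 on the
  whole line at once.
\<close>
lemma convex_weight_exists:
  fixes \<kappa> :: "real \<Rightarrow> real"
  assumes cont: "continuous_on UNIV \<kappa>" and pos: "\<And>t. 0 \<le> \<kappa> t"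
    and decay: "\<And>t. t \<ge> T \<Longrightarrow> \<kappa> t \<le> K * t powr (- \<sigma> - 2)" and "T > 0" "\<sigma> > 0"
  obtains w w' w'' where
    "\<And>t. (w has_real_derivative w' t) (at t)" "\<And>t. (w' has_real_derivative w'' t) (at t)"
    "\<And>t. 2 * (\<kappa> t * w t) \<le> w'' t" "\<And>t. 1 \<le> w t" "(w \<longlongrightarrow> 1) at_top" "(w' \<longlongrightarrow> 0) at_top"
proof -
  have "\<exists>m m'. (\<forall>t. (m has_vector_derivative m' t) (at t)) \<and>
    (\<forall>t. (m' has_vector_derivative \<kappa> t) (at t)) \<and> (m \<longlongrightarrow> 0) at_top \<and> (m' \<longlongrightarrow> 0) at_top"
    by (rule second_antiderivative_vanishing_at_infinity[OF cont, where T=T,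
          OF powr_weight(1,2)[OF \<open>\<sigma> > 0\<close>, of _ K] _ powr_weight(3,4)[OF \<open>\<sigma> > 0\<close>]])
       (use pos decay \<open>T > 0\<close> in auto)
  then obtain m m' where m: "\<And>t. (m has_real_derivative m' t) (at t)"
      "\<And>t. (m' has_real_derivative \<kappa> t) (at t)" "(m \<longlongrightarrow> 0) at_top" "(m' \<longlongrightarrow> 0) at_top"
    by (auto simp: has_real_derivative_iff_has_vector_derivative)
  have m0: "m t \<ge> 0" for t
  proof -
    have "norm (m t) \<le> m t - 0"
      by (rule norm_le_from_infinity2(2)[where T=t and \<phi>'=m' and \<phi>''=\<kappa> and u'=m' and u''=\<kappa>])
         (use m pos in \<open>auto simp: has_real_derivative_iff_has_vector_derivative[symmetric]\<close>)
    then show ?thesis by simp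
  qed
  define w where "w t = exp (2 * m t)" for t
  define w' where "w' t = 2 * m' t * w t" for t
  define w'' where "w'' t = 2 * \<kappa> t * w t + 2 * m' t * w' t" for t
  have dw: "(w has_real_derivative w' t) (at t)" for t
    unfolding w'_def unfolding w_def by (auto intro!: derivative_eq_intros m)
  show thesis
  proof (rule that)
    show "(w has_real_derivative w' t) (at t)" for t by (rule dw)
    have dm: "((\<lambda>t. 2 * m' t) has_real_derivative 2 * \<kappa> t) (at t)" for t
      using DERIV_cmult[OF m(2)] .
    show "(w' has_real_derivative w'' t) (at t)" for t
      using DERIV_mult[OF dm dw, of t]
      by (simp add: w'_def[abs_def] w''_def algebra_simps)
    have "0 \<le> 2 * m' t * w' t" for t
    proof -
      have "2 * m' t * w' t = (2 * m' t)\<^sup>2 * w t" by (simp add: w'_def power2_eq_square)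
      then show ?thesis by (simp add: w_def)
    qed
    then show "2 * (\<kappa> t * w t) \<le> w'' t" for t
      unfolding w''_def by (simp add: mult.assoc)
    show "1 \<le> w t" for t unfolding w_def using m0[of t] by simp
    have "((\<lambda>t. exp (2 * m t)) \<longlongrightarrow> exp (2 * 0)) at_top"
      by (intro tendsto_exp tendsto_mult tendsto_const m)
    then show w1: "(w \<longlongrightarrow> 1) at_top" by (simp add: w_def[abs_def])
    have "((\<lambda>t. 2 * m' t * w t) \<longlongrightarrow> 2 * 0 * 1) at_top"
      by (intro tendsto_mult tendsto_const m w1)
    then show "(w' \<longlongrightarrow> 0) at_top" by (simp add: w'_def[abs_def])
  qed
qed

lemma bounded_on_half_line_if_vanishing_at_infinity:
  fixes D :: "real \<Rightarrow> 'a::real_normed_vector"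
  assumes cont: "continuous_on {t0..} D" and lim: "(D \<longlongrightarrow> 0) at_top"
  shows "\<exists>M. \<forall>t\<ge>t0. norm (D t) \<le> M"
proof -
  have "\<forall>\<^sub>F t in at_top. dist (D t) 0 < 1" using lim by (intro tendstoD) auto
  then obtain N where N: "\<And>t. t \<ge> N \<Longrightarrow> norm (D t) < 1"
    by (auto simp: eventually_at_top_linorder)
  have "continuous_on {t0..N} D" by (rule continuous_on_subset[OF cont]) auto
  then have "bounded (D ` {t0..N})"
    by (intro compact_imp_bounded compact_continuous_image) auto
  then obtain B where B: "\<And>t. t \<in> {t0..N} \<Longrightarrow> norm (D t) \<le> B"
    by (auto simp: bounded_iff simp del: atLeastAtMost_iff)
  have "norm (D t) \<le> max B 1" if "t \<ge> t0" for t
    using B[of t] N[of t] that by (cases "t \<le> N") auto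
  then show ?thesis by blast
qed

text \<open>
  If S is the least constant with norm D \<le> S w on the half-line, integrating the differential
  inequality twice from infinity gives norm D \<le> (S / 2) w, so S vanishes.  All uniqueness
  statements below reduce to this one, including backward uniqueness on bounded intervals,
  since the Lipschitz bound may be arbitrarily large away from infinity.
\<close>
theorem second_order_unique_from_infinity:
  fixes D :: "real \<Rightarrow> 'a::banach"
  assumes \<kappa>: "continuous_on UNIV \<kappa>" "\<And>t. 0 \<le> \<kappa> t"
    "\<And>t. t \<ge> T \<Longrightarrow> \<kappa> t \<le> K * t powr (- \<sigma> - 2)" "T > 0" "\<sigma> > 0"
    and D: "\<And>t. (D has_vector_derivative D' t) (at t)"
    and D': "\<And>t. (D' has_vector_derivative D'' t) (at t)"
    and D'': "continuous_on UNIV D''"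
    and lim: "(D \<longlongrightarrow> 0) at_top"
    and le: "\<And>t. t \<ge> t0 \<Longrightarrow> norm (D'' t) \<le> \<kappa> t * norm (D t)"
    and t: "t \<ge> t0"
  shows "D t = 0" and "D' t = 0"
proof -
  obtain w w' w'' where w: "\<And>t. (w has_real_derivative w' t) (at t)"
      "\<And>t. (w' has_real_derivative w'' t) (at t)" "\<And>t. 2 * (\<kappa> t * w t) \<le> w'' t"
      "\<And>t. 1 \<le> w t" "(w \<longlongrightarrow> 1) at_top" "(w' \<longlongrightarrow> 0) at_top"
    using convex_weight_exists[OF \<kappa>] by metis
  have wpos: "w t > 0" for t using w(4)[of t] by linarith
  have "continuous_on {t0..} D"
    using D by (auto intro!: continuous_at_imp_continuous_on has_vector_derivative_continuous)
  then obtain M0 where M0: "\<And>t. t \<ge> t0 \<Longrightarrow> norm (D t) \<le> M0"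
    using bounded_on_half_line_if_vanishing_at_infinity[OF _ lim] by blast
  define S where "S = (SUP t\<in>{t0..}. norm (D t) / w t)"
  have bdd: "bdd_above ((\<lambda>t. norm (D t) / w t) ` {t0..})"
  proof (rule bdd_aboveI2)
    fix t assume "t \<in> {t0..}"
    then have "norm (D t) \<le> M0" using M0 by simp
    moreover have "norm (D t) / w t \<le> norm (D t)"
      using w(4)[of t] by (simp add: divide_le_eq mult_le_cancel_left1)
    ultimately show "norm (D t) / w t \<le> M0" by linarith
  qed
  have S: "norm (D t) \<le> S * w t" if "t \<ge> t0" for t
  proof -
    have "norm (D t) / w t \<le> S"
      unfolding S_def by (rule cSUP_upper[OF _ bdd]) (use that in auto)
    then show ?thesis using wpos[of t] by (simp add: field_simps)
  qed
  have "0 \<le> norm (D t) / w t" using wpos[of t] by simp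
  also have "\<dots> \<le> S" unfolding S_def by (rule cSUP_upper[OF _ bdd]) (use t in auto)
  finally have S0: "S \<ge> 0" .
  define \<phi> where "\<phi> t = S / 2 * w t" for t
  define \<phi>' where "\<phi>' t = S / 2 * w' t" for t
  define \<phi>'' where "\<phi>'' t = S / 2 * w'' t" for t
  have phi: "(\<phi> has_real_derivative \<phi>' t) (at t)" "(\<phi>' has_real_derivative \<phi>'' t) (at t)" for t
    unfolding \<phi>_def[abs_def] \<phi>'_def[abs_def] \<phi>''_def by (rule DERIV_cmult w)+
  have lims: "(\<phi> \<longlongrightarrow> S / 2 * 1) at_top" "(\<phi>' \<longlongrightarrow> 0) at_top"
  proof -
    show "(\<phi> \<longlongrightarrow> S / 2 * 1) at_top"
      unfolding \<phi>_def[abs_def] by (intro tendsto_mult tendsto_const w)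
    show "(\<phi>' \<longlongrightarrow> 0) at_top"
      unfolding \<phi>'_def[abs_def] by (intro tendsto_mult_right_zero w)
  qed
  have bound: "norm (D'' t) \<le> \<phi>'' t" if "t \<ge> t0" for t
  proof -
    have "norm (D'' t) \<le> \<kappa> t * norm (D t)" using le that .
    also have "\<dots> \<le> \<kappa> t * (S * w t)" using S[OF that] \<kappa>(2)[of t] by (intro mult_left_mono)
    also have "\<dots> = S / 2 * (2 * (\<kappa> t * w t))" by simp
    also have "\<dots> \<le> S / 2 * w'' t" using w(3)[of t] S0 by (intro mult_left_mono) auto
    finally show ?thesis by (simp add: \<phi>''_def)
  qed
  have D'0: "(D' \<longlongrightarrow> 0) at_top"
    by (rule deriv_tendsto_0_of_second_deriv_bound[OF D D' D'' phi(1) phi(2) bound lim lims])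
  have half: "norm (D s) \<le> S / 2 * w s" if "s \<ge> t0" for s
  proof -
    have "norm (D s) \<le> \<phi> s - S / 2 * 1"
      by (rule norm_le_from_infinity2(2)[where T=t0, OF D D' phi(1) phi(2) bound lim D'0 lims that])
    then show ?thesis using S0 by (simp add: \<phi>_def)
  qed
  have "(SUP s\<in>{t0..}. norm (D s) / w s) \<le> S / 2"
  proof (rule cSUP_least)
    show "norm (D s) / w s \<le> S / 2" if "s \<in> {t0..}" for s
      using half[of s] that wpos[of s] by (simp add: divide_le_eq)
  qed simp
  then have "S \<le> S / 2" by (simp only: S_def)
  then have "S = 0" using S0 by simp
  then show "D t = 0" using S[OF t] by simp
  have "norm (D' t) \<le> - \<phi>' t"
    by (rule norm_le_from_infinity2(1)[where T=t0, OF D D' phi(1) phi(2) bound lim D'0 lims t])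
  then show "D' t = 0" using \<open>S = 0\<close> by (simp add: \<phi>'_def)
qed

text \<open>
  The solution is the fixed point of the map that sends a curve to the second antiderivative,
  vanishing at infinity, of the right-hand side along it.  Curves are written as w times a
  bounded continuous function, and in these bounded functions the map has Lipschitz constant
  1/2 by the choice of w.
\<close>
theorem second_order_solution_from_infinity:
  fixes G :: "real \<Rightarrow> 'a::banach \<Rightarrow> 'a"
  assumes \<kappa>: "continuous_on UNIV \<kappa>" "\<And>t. 0 \<le> \<kappa> t"
    "\<And>t. t \<ge> T \<Longrightarrow> \<kappa> t \<le> K * t powr (- \<sigma> - 2)" "T > 0" "\<sigma> > 0"
    and G: "continuous_on UNIV (\<lambda>p. G (fst p) (snd p))"
    and lip: "\<And>t x y. norm (G t x - G t y) \<le> \<kappa> t * norm (x - y)"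
    and G0: "\<And>t. norm (G t 0) \<le> \<kappa> t"
  obtains u u' where "\<And>t. (u has_vector_derivative u' t) (at t)"
    "\<And>t. (u' has_vector_derivative G t (u t)) (at t)" "(u \<longlongrightarrow> 0) at_top"
proof -
  obtain w w' w'' where w: "\<And>t. (w has_real_derivative w' t) (at t)"
      "\<And>t. (w' has_real_derivative w'' t) (at t)" "\<And>t. 2 * (\<kappa> t * w t) \<le> w'' t"
      "\<And>t. 1 \<le> w t" "(w \<longlongrightarrow> 1) at_top" "(w' \<longlongrightarrow> 0) at_top"
    using convex_weight_exists[OF \<kappa>] by metis
  have wpos: "w t > 0" for t using w(4)[of t] by linarith
  have wne: "w t \<noteq> 0" for t using wpos[of t] by simp
  have wcont: "continuous_on UNIV w"
    using w(1) by (auto intro!: continuous_at_imp_continuous_on DERIV_isCont)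
  have Gcont: "continuous_on UNIV (\<lambda>t. G t (v t))" if "continuous_on UNIV v" for v
    using continuous_on_compose2[OF G continuous_on_Pair[OF continuous_on_id that]] by simp
  \<comment> \<open>The majorant belonging to a second derivative bounded by c times \<kappa> w.\<close>
  define \<phi> where "\<phi> c t = c / 2 * w t" for c t
  define \<phi>' where "\<phi>' c t = c / 2 * w' t" for c t
  define \<phi>'' where "\<phi>'' c t = c / 2 * w'' t" for c t
  have phi: "(\<phi> c has_real_derivative \<phi>' c t) (at t)" "(\<phi>' c has_real_derivative \<phi>'' c t) (at t)" for c t
    unfolding \<phi>_def[abs_def] \<phi>'_def[abs_def] \<phi>''_def by (rule DERIV_cmult w)+
  have lims: "(\<phi> c \<longlongrightarrow> c / 2 * 1) at_top" "(\<phi>' c \<longlongrightarrow> 0) at_top" for c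
  proof -
    show "(\<phi> c \<longlongrightarrow> c / 2 * 1) at_top"
      unfolding \<phi>_def[abs_def] by (intro tendsto_mult tendsto_const w)
    show "(\<phi>' c \<longlongrightarrow> 0) at_top"
      unfolding \<phi>'_def[abs_def] by (intro tendsto_mult_right_zero w)
  qed
  have dom: "c * (\<kappa> t * w t) \<le> \<phi>'' c t" if "c \<ge> 0" for c t
    using mult_left_mono[OF w(3)[of t], of "c / 2"] that by (simp add: \<phi>''_def)
  define f where "f \<beta> t = G t (w t *\<^sub>R apply_bcontfun \<beta> t)" for \<beta> :: "real \<Rightarrow>\<^sub>C 'a" and t
  have fcont: "continuous_on UNIV (f \<beta>)" for \<beta>
    unfolding f_def[abs_def] by (intro Gcont continuous_on_scaleR wcont) auto
  have fle: "norm (f \<beta> t) \<le> \<phi>'' (1 + norm \<beta>) t" for \<beta> t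
  proof -
    have "norm (f \<beta> t) \<le> norm (G t 0) + norm (f \<beta> t - G t 0)"
      by (metis add.commute diff_add_cancel norm_triangle_ineq)
    also have "\<dots> \<le> \<kappa> t + \<kappa> t * norm (w t *\<^sub>R apply_bcontfun \<beta> t - 0)"
      unfolding f_def by (intro add_mono G0 lip)
    also have "\<dots> \<le> \<kappa> t * w t + \<kappa> t * (w t * norm \<beta>)"
      using \<kappa>(2)[of t] w(4)[of t] norm_bounded[of \<beta> t]
      by (intro add_mono mult_left_mono) (auto simp: mult_le_cancel_left1)
    also have "\<dots> = (1 + norm \<beta>) * (\<kappa> t * w t)" by (simp add: algebra_simps)
    also have "\<dots> \<le> \<phi>'' (1 + norm \<beta>) t" by (rule dom) auto
    finally show ?thesis .
  qed
  have "\<forall>\<beta>. \<exists>u u'. (\<forall>t. (u has_vector_derivative u' t) (at t)) \<and>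
      (\<forall>t. (u' has_vector_derivative f \<beta> t) (at t)) \<and> (u \<longlongrightarrow> 0) at_top \<and> (u' \<longlongrightarrow> 0) at_top"
    using second_antiderivative_vanishing_at_infinity[OF fcont phi(1) phi(2) fle lims] by blast
  then obtain U U' where U: "\<And>\<beta> t. (U \<beta> has_vector_derivative U' \<beta> t) (at t)"
      "\<And>\<beta> t. (U' \<beta> has_vector_derivative f \<beta> t) (at t)"
      "\<And>\<beta>. (U \<beta> \<longlongrightarrow> 0) at_top" "\<And>\<beta>. (U' \<beta> \<longlongrightarrow> 0) at_top"
    by metis
  have Ule: "norm (U \<beta> t) \<le> (1 + norm \<beta>) / 2 * w t" for \<beta> t
  proof -
    have "norm (U \<beta> t) \<le> \<phi> (1 + norm \<beta>) t - (1 + norm \<beta>) / 2 * 1"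
      by (rule norm_le_from_infinity2(2)[where T=t, OF U(1,2) phi(1) phi(2) fle U(3,4) lims order_refl])
    also have "\<dots> \<le> (1 + norm \<beta>) / 2 * w t" by (simp add: \<phi>_def)
    finally show ?thesis .
  qed
  define \<Psi> where "\<Psi> \<beta> t = U \<beta> t /\<^sub>R w t" for \<beta> t
  have \<Psi>: "\<Psi> \<beta> \<in> bcontfun" for \<beta>
  proof (rule bcontfun_normI)
    have "continuous_on UNIV (U \<beta>)"
      using U(1) by (auto intro!: continuous_at_imp_continuous_on has_vector_derivative_continuous)
    then show "continuous_on UNIV (\<Psi> \<beta>)"
      unfolding \<Psi>_def[abs_def] by (intro continuous_intros wcont) (use wne in auto)
    show "norm (\<Psi> \<beta> t) \<le> (1 + norm \<beta>) / 2" for t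
      using Ule[of \<beta> t] wpos[of t] by (simp add: \<Psi>_def field_simps)
  qed
  have contr: "dist (Bcontfun (\<Psi> \<beta>1)) (Bcontfun (\<Psi> \<beta>2)) \<le> 1 / 2 * dist \<beta>1 \<beta>2" for \<beta>1 \<beta>2
  proof (rule dist_bound)
    fix t
    let ?c = "dist \<beta>1 \<beta>2"
    have le: "norm (f \<beta>1 s - f \<beta>2 s) \<le> \<phi>'' ?c s" for s
    proof -
      have "norm (f \<beta>1 s - f \<beta>2 s) \<le> \<kappa> s * norm (w s *\<^sub>R apply_bcontfun \<beta>1 s - w s *\<^sub>R apply_bcontfun \<beta>2 s)"
        unfolding f_def by (rule lip)
      also have "\<dots> = \<kappa> s * (w s * dist (apply_bcontfun \<beta>1 s) (apply_bcontfun \<beta>2 s))"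
        using wpos[of s] by (simp add: scaleR_diff_right[symmetric] dist_norm)
      also have "\<dots> \<le> \<kappa> s * (w s * ?c)"
        using \<kappa>(2)[of s] wpos[of s] dist_bounded by (intro mult_left_mono) auto
      also have "\<dots> = ?c * (\<kappa> s * w s)" by simp
      also have "\<dots> \<le> \<phi>'' ?c s" by (rule dom) auto
      finally show ?thesis .
    qed
    have U0: "((\<lambda>t. U \<beta>1 t - U \<beta>2 t) \<longlongrightarrow> 0) at_top"
      using tendsto_diff[OF U(3)[of \<beta>1] U(3)[of \<beta>2]] by simp
    have U'0: "((\<lambda>t. U' \<beta>1 t - U' \<beta>2 t) \<longlongrightarrow> 0) at_top"
      using tendsto_diff[OF U(4)[of \<beta>1] U(4)[of \<beta>2]] by simp
    have "norm (U \<beta>1 t - U \<beta>2 t) \<le> \<phi> ?c t - ?c / 2 * 1"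
      by (rule norm_le_from_infinity2(2)[where T=t, OF
            has_vector_derivative_diff[OF U(1) U(1)] has_vector_derivative_diff[OF U(2) U(2)]
            phi(1) phi(2) le U0 U'0 lims order_refl])
    also have "\<dots> \<le> ?c / 2 * w t" by (simp add: \<phi>_def)
    finally have "norm (U \<beta>1 t - U \<beta>2 t) / w t \<le> ?c / 2" using wpos[of t] by (simp add: field_simps)
    moreover have "norm (\<Psi> \<beta>1 t - \<Psi> \<beta>2 t) = norm (U \<beta>1 t - U \<beta>2 t) / w t"
      using wpos[of t] by (simp add: \<Psi>_def scaleR_diff_right[symmetric] divide_inverse mult.commute)
    ultimately show "dist (apply_bcontfun (Bcontfun (\<Psi> \<beta>1)) t) (apply_bcontfun (Bcontfun (\<Psi> \<beta>2)) t)
        \<le> 1 / 2 * dist \<beta>1 \<beta>2"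
      by (simp add: Bcontfun_inverse \<Psi> dist_norm)
  qed
  obtain \<beta> where \<beta>: "Bcontfun (\<Psi> \<beta>) = \<beta>"
    using banach_fix_type[of "1/2" "\<lambda>\<beta>. Bcontfun (\<Psi> \<beta>)"] contr by auto
  have "apply_bcontfun \<beta> t = U \<beta> t /\<^sub>R w t" for t
    using Bcontfun_inverse[OF \<Psi>[of \<beta>]] \<beta> by (simp add: \<Psi>_def)
  then have eq: "f \<beta> t = G t (U \<beta> t)" for t
    using wne[of t] by (simp add: f_def)
  show thesis
  proof (rule that[OF U(1) _ U(3)])
    show "(U' \<beta> has_vector_derivative G t (U \<beta> t)) (at t)" for t
      using U(2)[of \<beta> t] unfolding eq .
  qed
qed

section \<open>Cofactors and the force field\<close>

text \<open>
  The rows of the cofactor matrix are cross products of rows.  Writing this quadratic map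
  as the diagonal of a bilinear one lets the calculus of bounded bilinear maps supply continuity, differentiability and
  Lipschitz estimates, with the determinant recovered as a third of an inner product.
\<close>
definition cof_bilinear :: "real^3^3 \<Rightarrow> real^3^3 \<Rightarrow> real^3^3" where
  "cof_bilinear X Y = vector [cross3 (X $ 2) (Y $ 3), cross3 (X $ 3) (Y $ 1), cross3 (X $ 1) (Y $ 2)]"

definition cof :: "real^3^3 \<Rightarrow> real^3^3" where
  "cof X = cof_bilinear X X"

lemmas cof_simps = cof_def cof_bilinear_def cross3_def vector_3

lemma bounded_bilinear_cof: "bounded_bilinear cof_bilinear"
  unfolding bilinear_conv_bounded_bilinear[symmetric] bilinear_def
  by (auto intro!: linearI simp: vec_eq_iff forall_3 cof_simps algebra_simps)

lemma inner_matrix_3: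
  "inner (X :: real^3^3) Y = (\<Sum>i\<in>UNIV. \<Sum>j\<in>UNIV. X $ i $ j * Y $ i $ j)"
  by (simp add: inner_vec_def)

lemma det_eq_inner_cof: "det X = inner (cof X) X / 3"
  unfolding det_3 inner_matrix_3 sum_3 by (simp add: cof_simps algebra_simps)

lemma cof_mult: "X ** transpose (cof X) = det X *\<^sub>R mat 1"
  unfolding det_3 vec_eq_iff forall_3 matrix_matrix_mult_def sum_3 transpose_def mat_def
  by (simp_all add: cof_simps algebra_simps)

lemma matrix_inv_eqI:
  fixes X :: "real^'n^'n"
  assumes "X ** Y = mat 1"
  shows "matrix_inv X = Y"
proof -
  have YX: "Y ** X = mat 1" using assms by (simp add: matrix_left_right_inverse)
  have "X ** matrix_inv X = mat 1 \<and> matrix_inv X ** X = mat 1"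
    unfolding matrix_inv_def using assms YX by (rule someI[where x=Y, OF conjI])
  then show ?thesis using YX by (metis matrix_mul_assoc matrix_mul_lid matrix_mul_rid)
qed

lemma bounded_bilinear_matrix_mult:
  "bounded_bilinear ((**) :: real^'m^'n \<Rightarrow> real^'k^'m \<Rightarrow> real^'k^'n)"
  unfolding bilinear_conv_bounded_bilinear[symmetric] bilinear_def
  by (auto intro!: linearI simp: vec_eq_iff matrix_matrix_mult_def algebra_simps
      sum.distrib sum_distrib_left)

lemma matrix_inv_cof:
  fixes X :: "real^3^3"
  assumes "det X \<noteq> 0"
  shows "matrix_inv X = transpose (cof X) /\<^sub>R det X"
    and "X ** matrix_inv X = mat 1"
proof -
  have *: "X ** (transpose (cof X) /\<^sub>R det X) = mat 1"
    using cof_mult[of X] assms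
    by (simp add: bounded_bilinear.scaleR_right[OF bounded_bilinear_matrix_mult])
  then show "matrix_inv X = transpose (cof X) /\<^sub>R det X" by (rule matrix_inv_eqI)
  with * show "X ** matrix_inv X = mat 1" by simp
qed

lemma transpose_matrix_inv_eq_cof:
  "det X \<noteq> 0 \<Longrightarrow> transpose (matrix_inv X) = cof X /\<^sub>R det X"
  by (simp add: matrix_inv_cof transpose_def vec_eq_iff)

text \<open>
  The right-hand side of the equation, written as a power of the determinant times the
  cofactor matrix.  In this form it has no matrix inverse, and it is polynomial up to one
  scalar factor.
\<close>
definition force :: "real \<Rightarrow> real^3^3 \<Rightarrow> real^3^3" where
  "force \<gamma> X = (det X powr (- \<gamma>)) *\<^sub>R cof X"

lemma force_eq:
  assumes "det X > 0"
  shows "force \<gamma> X = (det X powr (1 - \<gamma>)) *\<^sub>R transpose (matrix_inv X)"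
proof -
  have "det X powr (1 - \<gamma>) = det X * det X powr (- \<gamma>)"
    using assms powr_add[of "det X" 1 "- \<gamma>"] by simp
  then show ?thesis
    using assms by (simp add: force_def transpose_matrix_inv_eq_cof)
qed

text \<open>
  Equivariance under left multiplication.  It transports estimates near the identity to
  estimates near any matrix M, with constants depending on M only through its determinant and
  the size of its inverse, the two quantities that the asymptotic hypotheses control.
\<close>
lemma force_mult:
  assumes "det M > 0" "det X > 0"
  shows "force \<gamma> (M ** X) = (det M powr (1 - \<gamma>)) *\<^sub>R (transpose (matrix_inv M) ** force \<gamma> X)"
proof -
  have "(M ** X) ** (matrix_inv X ** matrix_inv M) = M ** (X ** matrix_inv X) ** matrix_inv M"
    by (simp add: matrix_mul_assoc)
  also have "\<dots> = mat 1" using assms by (simp add: matrix_inv_cof(2))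
  finally have "matrix_inv (M ** X) = matrix_inv X ** matrix_inv M" by (rule matrix_inv_eqI)
  then show ?thesis
    using assms
    by (simp add: force_eq det_mul powr_mult matrix_transpose_mul mult.commute
       bounded_bilinear.scaleR_right[OF bounded_bilinear_matrix_mult])
qed

text \<open>
  Jacobi's formula; it identifies the force as minus the gradient of a function of the
  determinant.
\<close>
lemma det_has_derivative:
  assumes "(A has_vector_derivative A') (at t)"
  shows "((\<lambda>t. det (A t)) has_real_derivative inner (cof (A t)) A') (at t)"
proof -
  have "((\<lambda>t. A t $ i $ j) has_real_derivative A' $ i $ j) (at t)" for i j
    using bounded_linear.has_vector_derivative[OF bounded_linear_compose[OF bounded_linear_vec_nth bounded_linear_vec_nth] assms, of i j]
    by (simp add: has_real_derivative_iff_has_vector_derivative o_def)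
  then show ?thesis
    unfolding det_3 inner_matrix_3 sum_3
    by (auto intro!: derivative_eq_intros simp: cof_simps algebra_simps)
qed

lemma norm_matrix_le_opnorm: "norm M \<le> 9 * opnorm M"
proof -
  have "norm M \<le> (\<Sum>i\<in>UNIV. norm (M $ i))" by (simp add: norm_vec_def L2_set_le_sum)
  also have "\<dots> \<le> (\<Sum>i\<in>UNIV. \<Sum>j\<in>UNIV. \<bar>M $ i $ j\<bar>)" by (intro sum_mono norm_le_l1_cart)
  also have "\<dots> \<le> (\<Sum>i\<in>(UNIV::3 set). \<Sum>j\<in>(UNIV::3 set). opnorm M)"
    unfolding opnorm_def by (intro sum_mono matrix_component_le_onorm)
  finally show ?thesis by simp
qed

lemma opnorm_le_norm_matrix: "opnorm M \<le> 9 * norm M"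
proof -
  have "\<bar>M $ i $ j\<bar> \<le> norm M" for i j
    using component_le_norm_cart[of "M $ i" j] Finite_Cartesian_Product.norm_nth_le[of M i] by linarith
  then show ?thesis
    unfolding opnorm_def using onorm_le_matrix_component[of M "norm M"] by simp
qed

lemma opnorm_nonneg: "opnorm M \<ge> 0"
  unfolding opnorm_def by (rule onorm_pos_le) simp

text \<open>
  Radial retraction onto the closed ball of radius r, written as one formula that is jointly
  continuous in r and x.
\<close>
definition clip :: "real \<Rightarrow> 'a::real_normed_vector \<Rightarrow> 'a" where
  "clip r x = (r / max r (norm x)) *\<^sub>R x"

lemma norm_clip_le: "r > 0 \<Longrightarrow> norm (clip r x) \<le> r"
  by (auto simp: clip_def max_def)

lemma clip_eq: "r > 0 \<Longrightarrow> norm x \<le> r \<Longrightarrow> clip r x = x"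
  by (simp add: clip_def max_def)

text \<open>
  The constant 2 comes from treating the change of the scalar factor and the change of the
  vector separately; any constant independent of the radius serves.
\<close>
lemma clip_lipschitz:
  assumes "r > 0"
  shows "norm (clip r x - clip r y) \<le> 2 * norm (x - y)"
proof -
  define m m' where "m = max r (norm x)" and "m' = max r (norm y)"
  have m: "m \<ge> r" "m' \<ge> r" "norm y \<le> m'" "m > 0" "m' > 0"
    using assms by (auto simp: m_def m'_def)
  have mm: "\<bar>m' - m\<bar> \<le> norm (x - y)"
    using norm_triangle_ineq3[of x y] by (auto simp: m_def m'_def max_def abs_if split: if_splits)
  have "clip r x - clip r y = (r / m) *\<^sub>R (x - y) + (r / m - r / m') *\<^sub>R y"
    by (simp add: clip_def m_def m'_def algebra_simps)
  then have "norm (clip r x - clip r y) \<le> norm ((r / m) *\<^sub>R (x - y)) + norm ((r / m - r / m') *\<^sub>R y)"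
    by (metis norm_triangle_ineq)
  also have "norm ((r / m) *\<^sub>R (x - y)) \<le> norm (x - y)"
    using m assms by (simp add: divide_le_eq mult.commute mult_right_mono)
  also have "norm ((r / m - r / m') *\<^sub>R y) \<le> norm (x - y)"
  proof -
    have "r / m - r / m' = (r / m) * ((m' - m) / m')" using m by (simp add: field_simps)
    then have "norm ((r / m - r / m') *\<^sub>R y) = (r / m) * (\<bar>m' - m\<bar> * (norm y / m'))"
      using m assms by (simp add: abs_mult)
    also have "\<dots> \<le> 1 * (\<bar>m' - m\<bar> * 1)"
      using m assms by (intro mult_mono) auto
    finally show ?thesis using mm by simp
  qed
  finally show ?thesis by simp
qed

text \<open>
  Bounding the determinant from below inside the power removes the singularity and keeps the
  gradient structure: the cut force is still minus the gradient of a function of the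
  determinant, so the cut equation conserves an energy as well.
\<close>
definition cut_force :: "real \<Rightarrow> real \<Rightarrow> real^3^3 \<Rightarrow> real^3^3" where
  "cut_force \<gamma> \<delta> X = (max \<delta> (det X) powr (- \<gamma>)) *\<^sub>R cof X"

lemma cut_force_eq_force: "\<delta> \<le> det X \<Longrightarrow> cut_force \<gamma> \<delta> X = force \<gamma> X"
  by (simp add: cut_force_def force_def max_def)

lemma powr_max_lipschitz:
  fixes \<delta> \<gamma> x y :: real
  assumes "\<delta> > 0" "\<gamma> > 0"
  shows "\<bar>max \<delta> x powr (- \<gamma>) - max \<delta> y powr (- \<gamma>)\<bar> \<le> \<gamma> * \<delta> powr (- \<gamma> - 1) * \<bar>x - y\<bar>"
proof -
  have "norm (max \<delta> x powr (- \<gamma>) - max \<delta> y powr (- \<gamma>))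
      \<le> (\<gamma> * \<delta> powr (- \<gamma> - 1)) * norm (max \<delta> x - max \<delta> y)"
  proof (rule field_differentiable_bound[of "{\<delta>..}" "\<lambda>z. z powr (- \<gamma>)" "\<lambda>z. - \<gamma> * z powr (- \<gamma> - 1)"])
    show "((\<lambda>z. z powr (- \<gamma>)) has_field_derivative - \<gamma> * z powr (- \<gamma> - 1)) (at z within {\<delta>..})"
      if "z \<in> {\<delta>..}" for z
      using has_real_derivative_powr[of z "- \<gamma>"] that assms
      by (auto intro: has_field_derivative_at_within)
    show "norm (- \<gamma> * z powr (- \<gamma> - 1)) \<le> \<gamma> * \<delta> powr (- \<gamma> - 1)" if "z \<in> {\<delta>..}" for z
      using that assms powr_mono2'[of "- \<gamma> - 1" \<delta> z] by (simp add: abs_mult)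
  qed auto
  also have "\<dots> \<le> \<gamma> * \<delta> powr (- \<gamma> - 1) * \<bar>x - y\<bar>"
    using assms by (intro mult_left_mono) auto
  finally show ?thesis by simp
qed

lemma cof_det_lipschitz:
  obtains K :: real where "K > 0"
    "\<And>X. norm (cof X) \<le> K * (norm X)\<^sup>2"
    "\<And>X Y R. norm X \<le> R \<Longrightarrow> norm Y \<le> R \<Longrightarrow> norm (cof X - cof Y) \<le> 2 * K * R * norm (X - Y)"
    "\<And>(X::real^3^3) Y R. norm X \<le> R \<Longrightarrow> norm Y \<le> R \<Longrightarrow> \<bar>det X - det Y\<bar> \<le> K * R\<^sup>2 * norm (X - Y)"
proof -
  interpret B: bounded_bilinear cof_bilinear by (rule bounded_bilinear_cof)
  obtain K where K: "K > 0" "\<And>X Y. norm (cof_bilinear X Y) \<le> norm X * norm Y * K"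
    using B.pos_bounded by blast
  have c1: "norm (cof X) \<le> K * (norm X)\<^sup>2" for X
    using K(2)[of X X] by (simp add: cof_def power2_eq_square mult_ac)
  have c2: "norm (cof X - cof Y) \<le> 2 * K * R * norm (X - Y)" if "norm X \<le> R" "norm Y \<le> R" for X Y :: "real^3^3" and R
  proof -
    have "cof X - cof Y = cof_bilinear X (X - Y) + cof_bilinear (X - Y) Y"
      by (simp add: cof_def B.diff_left B.diff_right)
    then have "norm (cof X - cof Y) \<le> norm (cof_bilinear X (X - Y)) + norm (cof_bilinear (X - Y) Y)"
      by (metis norm_triangle_ineq)
    also have "\<dots> \<le> norm X * norm (X - Y) * K + norm (X - Y) * norm Y * K"
      by (intro add_mono K)
    also have "\<dots> \<le> R * norm (X - Y) * K + norm (X - Y) * R * K"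
      using that K(1) by (intro add_mono mult_right_mono mult_left_mono) auto
    finally show ?thesis by (simp add: algebra_simps)
  qed
  have c3: "\<bar>det X - det Y\<bar> \<le> K * R\<^sup>2 * norm (X - Y)" if "norm X \<le> R" "norm Y \<le> R" for X Y :: "real^3^3" and R
  proof -
    have R: "R \<ge> 0" using norm_ge_zero[of X] that by linarith
    have "3 * \<bar>det X - det Y\<bar> = \<bar>inner (cof X - cof Y) X + inner (cof Y) (X - Y)\<bar>"
    proof -
      have "3 * (det X - det Y) = inner (cof X - cof Y) X + inner (cof Y) (X - Y)"
        by (simp add: det_eq_inner_cof inner_diff_left inner_diff_right field_simps)
      then show ?thesis by (metis abs_mult abs_numeral)
    qed
    also have "\<dots> \<le> \<bar>inner (cof X - cof Y) X\<bar> + \<bar>inner (cof Y) (X - Y)\<bar>" by (rule abs_triangle_ineq)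
    also have "\<dots> \<le> norm (cof X - cof Y) * norm X + norm (cof Y) * norm (X - Y)"
      by (intro add_mono Cauchy_Schwarz_ineq2)
    also have "\<dots> \<le> (2 * K * R * norm (X - Y)) * R + (K * R\<^sup>2) * norm (X - Y)"
    proof (intro add_mono mult_mono c2 that)
      show "norm (cof Y) \<le> K * R\<^sup>2"
        using c1[of Y] K(1) that by (smt (verit) mult_left_mono power_mono norm_ge_zero)
    qed (use K(1) R in auto)
    also have "\<dots> = 3 * (K * R\<^sup>2 * norm (X - Y))" by (simp add: power2_eq_square)
    finally show ?thesis by simp
  qed
  show thesis by (rule that[OF K(1) c1 c2 c3])
qed

lemma cut_force_lipschitz:
  assumes "\<delta> > 0" "\<gamma> > 0"
  shows "\<exists>C\<ge>0. \<forall>R X Y. norm X \<le> R \<longrightarrow> norm Y \<le> R \<longrightarrow>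
    norm (cut_force \<gamma> \<delta> X - cut_force \<gamma> \<delta> Y) \<le> C * (R + R ^ 4) * norm (X - Y)"
proof -
  obtain K where K: "K > 0" "\<And>X. norm (cof X) \<le> K * (norm X)\<^sup>2"
    "\<And>X Y R. norm X \<le> R \<Longrightarrow> norm Y \<le> R \<Longrightarrow> norm (cof X - cof Y) \<le> 2 * K * R * norm (X - Y)"
    "\<And>(X::real^3^3) Y R. norm X \<le> R \<Longrightarrow> norm Y \<le> R \<Longrightarrow> \<bar>det X - det Y\<bar> \<le> K * R\<^sup>2 * norm (X - Y)"
    using cof_det_lipschitz by metis
  define a b where "a = \<delta> powr (- \<gamma>) * (2 * K)" and "b = \<gamma> * \<delta> powr (- \<gamma> - 1) * K * K"
  have ab: "a \<ge> 0" "b \<ge> 0" using assms K(1) by (auto simp: a_def b_def)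
  have "norm (cut_force \<gamma> \<delta> X - cut_force \<gamma> \<delta> Y) \<le> (a + b) * (R + R ^ 4) * norm (X - Y)"
    if X: "norm X \<le> R" and Y: "norm Y \<le> R" for R X Y
  proof -
    define h where "h Z = max \<delta> (det Z) powr (- \<gamma>)" for Z :: "real^3^3"
    have R: "R \<ge> 0" using norm_ge_zero[of X] that by linarith
    have h: "\<bar>h X\<bar> \<le> \<delta> powr (- \<gamma>)"
      unfolding h_def using assms by (auto intro!: powr_mono2')
    have "\<bar>h X - h Y\<bar> \<le> \<gamma> * \<delta> powr (- \<gamma> - 1) * \<bar>det X - det Y\<bar>"
      unfolding h_def using powr_max_lipschitz[OF assms] .
    also have "\<dots> \<le> \<gamma> * \<delta> powr (- \<gamma> - 1) * (K * R\<^sup>2 * norm (X - Y))"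
      using assms by (intro mult_left_mono K X Y) auto
    finally have hd: "\<bar>h X - h Y\<bar> \<le> \<gamma> * \<delta> powr (- \<gamma> - 1) * (K * R\<^sup>2 * norm (X - Y))" .
    have cY: "norm (cof Y) \<le> K * R\<^sup>2"
      using K(2)[of Y] K(1) Y by (smt (verit) mult_left_mono power_mono norm_ge_zero)
    have "cut_force \<gamma> \<delta> X - cut_force \<gamma> \<delta> Y = h X *\<^sub>R (cof X - cof Y) + (h X - h Y) *\<^sub>R cof Y"
      by (simp add: cut_force_def h_def algebra_simps)
    then have "norm (cut_force \<gamma> \<delta> X - cut_force \<gamma> \<delta> Y)
        \<le> \<bar>h X\<bar> * norm (cof X - cof Y) + \<bar>h X - h Y\<bar> * norm (cof Y)"
      by (metis norm_triangle_ineq norm_scaleR)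
    also have "\<dots> \<le> \<delta> powr (- \<gamma>) * (2 * K * R * norm (X - Y))
        + \<gamma> * \<delta> powr (- \<gamma> - 1) * (K * R\<^sup>2 * norm (X - Y)) * (K * R\<^sup>2)"
      using K(1) assms R by (intro add_mono mult_mono h hd cY K X Y) auto
    also have "\<dots> = (a * R + b * R ^ 4) * norm (X - Y)"
      by (simp add: a_def b_def algebra_simps power2_eq_square power4_eq_xxxx)
    also have "\<dots> \<le> ((a + b) * (R + R ^ 4)) * norm (X - Y)"
      using ab R by (intro mult_right_mono) (auto simp: algebra_simps)
    finally show ?thesis .
  qed
  with ab show ?thesis by (intro exI[of _ "a + b"]) auto
qed

lemma continuous_on_cof: "continuous_on S f \<Longrightarrow> continuous_on S (\<lambda>x. cof (f x))"
  unfolding cof_def by (rule bounded_bilinear.continuous_on[OF bounded_bilinear_cof])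

lemma continuous_on_det3:
  fixes f :: "'a::topological_space \<Rightarrow> real^3^3"
  shows "continuous_on S f \<Longrightarrow> continuous_on S (\<lambda>x. det (f x))"
  unfolding det_eq_inner_cof by (intro continuous_intros continuous_on_cof) auto

lemma continuous_on_cut_force:
  assumes "\<delta> > 0" "continuous_on S f"
  shows "continuous_on S (\<lambda>x. cut_force \<gamma> \<delta> (f x))"
  unfolding cut_force_def using assms
  by (intro continuous_intros continuous_on_cof continuous_on_det3) (auto simp: max_def)

lemma continuous_on_force:
  assumes "continuous_on S f" "\<And>x. x \<in> S \<Longrightarrow> det (f x) \<noteq> 0"
  shows "continuous_on S (\<lambda>x. force \<gamma> (f x))"
  unfolding force_def using assms
  by (intro continuous_intros continuous_on_cof continuous_on_det3) auto

lemma continuous_on_clip: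
  assumes "continuous_on S r" "continuous_on S f" "\<And>x. x \<in> S \<Longrightarrow> r x > 0"
  shows "continuous_on S (\<lambda>x. clip (r x) (f x))"
  unfolding clip_def using assms
  by (intro continuous_intros) (auto simp: max_def dest: assms(3))

section \<open>Smoothness of solutions\<close>

text \<open>
  Differentiability k times, in terms of some chosen derivatives instead of iterates of
  the derivative operator; this makes the closure properties direct inductions on k.
\<close>
primrec times_differentiable :: "nat \<Rightarrow> (real \<Rightarrow> 'a::real_normed_vector) \<Rightarrow> bool" where
  "times_differentiable 0 f = True"
| "times_differentiable (Suc k) f =
    (\<exists>f'. (\<forall>t. (f has_vector_derivative f' t) (at t)) \<and> times_differentiable k f')"

lemma times_differentiable_SucI:
  "(\<And>t. (f has_vector_derivative f' t) (at t)) \<Longrightarrow> times_differentiable k f' \<Longrightarrow>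
    times_differentiable (Suc k) f"
  by auto

lemma times_differentiable_SucE:
  assumes "times_differentiable (Suc k) f"
  obtains f' where "\<And>t. (f has_vector_derivative f' t) (at t)" "times_differentiable k f'"
  using assms by auto

declare times_differentiable.simps(2) [simp del]

lemma times_differentiable_mono: "times_differentiable (Suc k) f \<Longrightarrow> times_differentiable k f"
proof (induction k arbitrary: f)
  case (Suc k)
  obtain f' where f': "\<And>t. (f has_vector_derivative f' t) (at t)" "times_differentiable (Suc k) f'"
    by (rule times_differentiable_SucE[OF Suc.prems]) (rule that)
  show ?case by (rule times_differentiable_SucI[OF f'(1) Suc.IH[OF f'(2)]])
qed simp

lemma times_differentiable_add:
  "times_differentiable k f \<Longrightarrow> times_differentiable k g \<Longrightarrow> times_differentiable k (\<lambda>t. f t + g t)"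
proof (induction k arbitrary: f g)
  case (Suc k)
  obtain f' where f': "\<And>t. (f has_vector_derivative f' t) (at t)" "times_differentiable k f'"
    by (rule times_differentiable_SucE[OF Suc.prems(1)]) (rule that)
  obtain g' where g': "\<And>t. (g has_vector_derivative g' t) (at t)" "times_differentiable k g'"
    by (rule times_differentiable_SucE[OF Suc.prems(2)]) (rule that)
  show ?case
    by (rule times_differentiable_SucI[OF has_vector_derivative_add[OF f'(1) g'(1)] Suc.IH[OF f'(2) g'(2)]])
qed simp

lemma times_differentiable_bilinear:
  assumes B: "bounded_bilinear B"
  shows "times_differentiable k f \<Longrightarrow> times_differentiable k g \<Longrightarrow> times_differentiable k (\<lambda>t. B (f t) (g t))"
proof (induction k arbitrary: f g)
  case (Suc k)
  obtain f' where f': "\<And>t. (f has_vector_derivative f' t) (at t)" "times_differentiable k f'"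
    by (rule times_differentiable_SucE[OF Suc.prems(1)]) (rule that)
  obtain g' where g': "\<And>t. (g has_vector_derivative g' t) (at t)" "times_differentiable k g'"
    by (rule times_differentiable_SucE[OF Suc.prems(2)]) (rule that)
  have "times_differentiable k (\<lambda>t. B (f t) (g' t) + B (f' t) (g t))"
    by (rule times_differentiable_add[OF
          Suc.IH[OF times_differentiable_mono[OF Suc.prems(1)] g'(2)]
          Suc.IH[OF f'(2) times_differentiable_mono[OF Suc.prems(2)]]])
  then show ?case
    by (rule times_differentiable_SucI[OF bounded_bilinear.has_vector_derivative[OF B f'(1) g'(1)]])
qed simp

lemma times_differentiable_const: "times_differentiable k (\<lambda>t. c)"
proof (induction k arbitrary: c)
  case (Suc k)
  show ?case by (rule times_differentiable_SucI[OF has_vector_derivative_const Suc.IH])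
qed simp

lemma times_differentiable_powr:
  fixes f :: "real \<Rightarrow> real"
  assumes pos: "\<And>t. f t > 0"
  shows "times_differentiable k f \<Longrightarrow> times_differentiable k (\<lambda>t. f t powr r)"
proof (induction k arbitrary: r)
  case (Suc k)
  obtain f' where f': "\<And>t. (f has_vector_derivative f' t) (at t)" "times_differentiable k f'"
    by (rule times_differentiable_SucE[OF Suc.prems]) (rule that)
  have "times_differentiable k (\<lambda>t. r * (f t powr (r - 1) * f' t))"
    by (rule times_differentiable_bilinear[OF bounded_bilinear_mult times_differentiable_const
          times_differentiable_bilinear[OF bounded_bilinear_mult
            Suc.IH[OF times_differentiable_mono[OF Suc.prems]] f'(2)]])
  moreover have "((\<lambda>t. f t powr r) has_vector_derivative r * (f t powr (r - 1) * f' t)) (at t)" for t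
  proof -
    have "(f has_real_derivative f' t) (at t)"
      using f'(1) by (simp add: has_real_derivative_iff_has_vector_derivative)
    from DERIV_chain2[OF has_real_derivative_powr[OF pos] this]
    show ?thesis by (simp add: has_real_derivative_iff_has_vector_derivative mult.assoc)
  qed
  ultimately show ?case by (intro times_differentiable_SucI)
qed simp

lemma nth_vderiv_Suc: "nth_vderiv (Suc k) f = nth_vderiv k (\<lambda>t. vector_derivative f (at t))"
  by (simp add: nth_vderiv_def funpow_Suc_right del: funpow.simps)

lemma smooth_if_times_differentiable:
  assumes "\<And>k. times_differentiable k f"
  shows "smooth f"
proof -
  have "nth_vderiv k f differentiable (at t)" if "times_differentiable (Suc k) f" for k t and f :: "real \<Rightarrow> 'a"
    using that
  proof (induction k arbitrary: f)
    case 0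
    obtain f' where "\<And>t. (f has_vector_derivative f' t) (at t)"
      by (rule times_differentiable_SucE[OF 0]) (rule that)
    then have "f differentiable (at t)" by (rule differentiableI_vector)
    then show ?case by (simp add: nth_vderiv_def)
  next
    case (Suc k)
    obtain f' where f': "\<And>t. (f has_vector_derivative f' t) (at t)" "times_differentiable (Suc k) f'"
      by (rule times_differentiable_SucE[OF Suc.prems]) (rule that)
    have "(\<lambda>t. vector_derivative f (at t)) = f'" using f'(1) by (intro ext vector_derivative_at)
    then show ?case using Suc.IH[OF f'(2)] by (simp add: nth_vderiv_Suc)
  qed
  then show ?thesis using assms unfolding smooth_def by simp
qed

lemma times_differentiable_force:
  assumes "times_differentiable k A" "\<And>t. det (A t) > 0"
  shows "times_differentiable k (\<lambda>t. force \<gamma> (A t))"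
proof -
  have c: "times_differentiable k (\<lambda>t. cof (A t))"
    unfolding cof_def by (rule times_differentiable_bilinear[OF bounded_bilinear_cof assms(1) assms(1)])
  have "times_differentiable k (\<lambda>t. 1 / 3 * inner (cof (A t)) (A t))"
    by (rule times_differentiable_bilinear[OF bounded_bilinear_mult times_differentiable_const
        times_differentiable_bilinear[OF bounded_bilinear_inner c assms(1)]])
  then have d: "times_differentiable k (\<lambda>t. det (A t))" by (simp add: det_eq_inner_cof)
  show ?thesis
    unfolding force_def
    by (rule times_differentiable_bilinear[OF bounded_bilinear_scaleR times_differentiable_powr[OF assms(2) d] c])
qed

lemma nth_vderiv_simps:
  assumes "\<And>t. (A has_vector_derivative A' t) (at t)" "\<And>t. (A' has_vector_derivative A'' t) (at t)"
  shows "nth_vderiv 0 A = A" "nth_vderiv 1 A = A'" "nth_vderiv 2 A = A''"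
proof -
  have *: "(\<lambda>t. vector_derivative A (at t)) = A'" "(\<lambda>t. vector_derivative A' (at t)) = A''"
    using assms by (auto intro!: ext vector_derivative_at)
  show "nth_vderiv 0 A = A" by (simp add: nth_vderiv_def)
  show "nth_vderiv 1 A = A'" by (simp add: nth_vderiv_def *)
  show "nth_vderiv 2 A = A''" by (simp add: nth_vderiv_def numeral_2_eq_2 *)
qed

text \<open>
  Twice differentiable solutions are smooth by bootstrapping: the force is a smooth function of
  the solution, so each order of differentiability of A passes to A'' and hence gains two.
\<close>
lemma global_solution_iff:
  "global_solution \<gamma> A \<longleftrightarrow> (\<exists>A'. (\<forall>t. (A has_vector_derivative A' t) (at t)) \<and>
    (\<forall>t. (A' has_vector_derivative force \<gamma> (A t)) (at t)) \<and> (\<forall>t. det (A t) > 0))"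
proof
  assume g: "global_solution \<gamma> A"
  then have pos: "det (A t) > 0" for t unfolding global_solution_def GL_pos_def by blast
  have "nth_vderiv k A differentiable (at t)" for k t
    using g unfolding global_solution_def smooth_def by blast
  then have d: "(nth_vderiv k A has_vector_derivative nth_vderiv (Suc k) A t) (at t)" for k t
    by (simp add: nth_vderiv_def vector_derivative_works)
  have "nth_vderiv 2 A t = force \<gamma> (A t)" for t
    using g pos[of t] by (simp add: force_eq global_solution_def)
  then have "(nth_vderiv 1 A has_vector_derivative force \<gamma> (A t)) (at t)" for t
    using d[of 1 t] by (simp add: numeral_2_eq_2)
  moreover have "(A has_vector_derivative nth_vderiv 1 A t) (at t)" for t
    using d[of 0 t] by (simp add: nth_vderiv_def)
  ultimately show "\<exists>A'. (\<forall>t. (A has_vector_derivative A' t) (at t)) \<and>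
    (\<forall>t. (A' has_vector_derivative force \<gamma> (A t)) (at t)) \<and> (\<forall>t. det (A t) > 0)"
    using pos by blast
next
  assume "\<exists>A'. (\<forall>t. (A has_vector_derivative A' t) (at t)) \<and>
    (\<forall>t. (A' has_vector_derivative force \<gamma> (A t)) (at t)) \<and> (\<forall>t. det (A t) > 0)"
  then obtain A' where A': "\<And>t. (A has_vector_derivative A' t) (at t)"
    "\<And>t. (A' has_vector_derivative force \<gamma> (A t)) (at t)" "\<And>t. det (A t) > 0" by blast
  have "times_differentiable k A" for k
  proof (induction k)
    case (Suc k)
    then have "times_differentiable k (\<lambda>t. force \<gamma> (A t))"
      using A'(3) by (rule times_differentiable_force)
    then have "times_differentiable (Suc k) A'" by (rule times_differentiable_SucI[OF A'(2)])
    then have "times_differentiable k A'" by (rule times_differentiable_mono)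
    then show ?case by (rule times_differentiable_SucI[OF A'(1)])
  qed simp
  then have "smooth A" by (rule smooth_if_times_differentiable)
  moreover have "continuous_on UNIV A"
    using A'(1) by (auto intro!: continuous_at_imp_continuous_on has_vector_derivative_continuous)
  ultimately show "global_solution \<gamma> A"
    unfolding global_solution_def GL_pos_def using nth_vderiv_simps(3)[OF A'(1,2)] A'(3)
    by (auto simp: force_eq)
qed

section \<open>Uniqueness of solutions with the same asymptotics\<close>

text \<open>
  The assumed Lipschitz bound controls large times.  On a bounded interval both solutions stay in
  a compact part of the group of matrices with positive determinant, where the force agrees with
  a cut force, which is Lipschitz on balls; this avoids any convexity argument.
  The two bounds are merged into a single one that is constant before T.
\<close>
lemma solutions_agree_if_asymptotic:
  fixes A B :: "real \<Rightarrow> real^3^3"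
  assumes "\<gamma> > 0" "\<sigma> > 0" "T > 0"
    and A: "\<And>t. (A has_vector_derivative A' t) (at t)"
      "\<And>t. (A' has_vector_derivative force \<gamma> (A t)) (at t)" "\<And>t. det (A t) > 0"
    and B: "\<And>t. (B has_vector_derivative B' t) (at t)"
      "\<And>t. (B' has_vector_derivative force \<gamma> (B t)) (at t)" "\<And>t. det (B t) > 0"
    and lim: "((\<lambda>t. A t - B t) \<longlongrightarrow> 0) at_top"
    and lip: "\<And>t. t \<ge> T \<Longrightarrow>
      norm (force \<gamma> (A t) - force \<gamma> (B t)) \<le> K * t powr (- \<sigma> - 2) * norm (A t - B t)"
  shows "A = B"
proof
  fix t0
  have cA: "continuous_on S A" and cB: "continuous_on S B" for S
    using A(1) B(1) by (auto intro!: continuous_at_imp_continuous_on has_vector_derivative_continuous)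
  define I where "I = {min t0 T..T}"
  have I: "compact I" "I \<noteq> {}" by (auto simp: I_def)
  have cdet: "continuous_on I (\<lambda>t. min (det (A t)) (det (B t)))"
    by (intro continuous_on_min continuous_on_det3 cA cB)
  obtain s where s: "s \<in> I" "\<And>t. t \<in> I \<Longrightarrow> min (det (A s)) (det (B s)) \<le> min (det (A t)) (det (B t))"
    using continuous_attains_inf[OF I cdet] by blast
  define \<delta> where "\<delta> = min (det (A s)) (det (B s))"
  have \<delta>: "\<delta> > 0" using A(3) B(3) by (simp add: \<delta>_def)
  have "continuous_on I (\<lambda>t. max (norm (A t)) (norm (B t)))"
    by (intro continuous_on_max continuous_on_norm cA cB)
  then obtain r where r: "r \<in> I"
      "\<And>t. t \<in> I \<Longrightarrow> max (norm (A t)) (norm (B t)) \<le> max (norm (A r)) (norm (B r))"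
    using continuous_attains_sup[OF I] by blast
  define R where "R = max (norm (A r)) (norm (B r))"
  obtain C where C: "C \<ge> 0" "\<And>R X Y. norm X \<le> R \<Longrightarrow> norm Y \<le> R \<Longrightarrow>
      norm (cut_force \<gamma> \<delta> X - cut_force \<gamma> \<delta> Y) \<le> C * (R + R ^ 4) * norm (X - Y)"
    using cut_force_lipschitz[OF \<delta> \<open>\<gamma> > 0\<close>] by blast
  define L where "L = C * (R + R ^ 4)"
  have L: "norm (force \<gamma> (A t) - force \<gamma> (B t)) \<le> L * norm (A t - B t)" if "t \<in> I" for t
    using C(2)[of "A t" R "B t"] r(2)[OF that] s(2)[OF that]
    by (simp add: cut_force_eq_force \<delta>_def R_def L_def)
  define M where "M = max \<bar>K\<bar> (L * T powr (\<sigma> + 2))"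
  define \<kappa> where "\<kappa> t = M * max t T powr (- \<sigma> - 2)" for t
  have M0: "M \<ge> 0" by (simp add: M_def)
  have "(\<lambda>t. A t - B t) t0 = 0"
  proof (rule second_order_unique_from_infinity(1)[where D="\<lambda>t. A t - B t" and D'="\<lambda>t. A' t - B' t"
        and D''="\<lambda>t. force \<gamma> (A t) - force \<gamma> (B t)" and \<kappa>=\<kappa> and T=T and K=M and \<sigma>=\<sigma> and t0=t0])
    show "continuous_on UNIV \<kappa>"
      unfolding \<kappa>_def using \<open>T > 0\<close> by (intro continuous_intros) (auto simp: max_def)
    show "0 \<le> \<kappa> t" for t using M0 by (simp add: \<kappa>_def)
    show "\<kappa> t \<le> M * t powr (- \<sigma> - 2)" if "T \<le> t" for t using that by (simp add: \<kappa>_def max_absorb1)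
    show "((\<lambda>t. A t - B t) has_vector_derivative A' t - B' t) (at t)" for t
      by (intro has_vector_derivative_diff A B)
    show "((\<lambda>t. A' t - B' t) has_vector_derivative force \<gamma> (A t) - force \<gamma> (B t)) (at t)" for t
      by (intro has_vector_derivative_diff A B)
    show "continuous_on UNIV (\<lambda>t. force \<gamma> (A t) - force \<gamma> (B t))"
      using A(3) B(3) by (intro continuous_on_diff continuous_on_force cA cB) (simp_all add: less_imp_neq[symmetric])
    show "norm (force \<gamma> (A t) - force \<gamma> (B t)) \<le> \<kappa> t * norm (A t - B t)" if "t \<ge> t0" for t
    proof (cases "t \<ge> T")
      case True
      have "K * t powr (- \<sigma> - 2) \<le> M * t powr (- \<sigma> - 2)"
        by (intro mult_right_mono) (auto simp: M_def)
      then have "K * t powr (- \<sigma> - 2) * norm (A t - B t) \<le> \<kappa> t * norm (A t - B t)"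
        using True by (intro mult_right_mono) (auto simp: \<kappa>_def max_absorb1)
      then show ?thesis using lip[OF True] by linarith
    next
      case False
      have "L = L * T powr (\<sigma> + 2) * T powr (- \<sigma> - 2)"
        using \<open>T > 0\<close> by (simp flip: powr_add)
      also have "\<dots> \<le> \<kappa> t"
        using False by (simp add: \<kappa>_def max_absorb2 M_def mult_right_mono)
      finally have "L * norm (A t - B t) \<le> \<kappa> t * norm (A t - B t)" by (rule mult_right_mono) simp
      moreover have "t \<in> I" using False that by (simp add: I_def)
      ultimately show ?thesis using L by fastforce
    qed
  qed (use assms in auto)
  then show "A t0 = B t0" by simp
qed

section \<open>Continuation to the whole line by energy conservation\<close>

text \<open>
  The potential energy of the cut force as a function of the determinant x.  It is the original
  potential for x \<ge> \<delta>, and for x \<le> \<delta> it is at least the value at \<delta>.  A motion whose total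
  energy is below that value therefore cannot reach determinants below \<delta>.
\<close>
lemma cut_potential_exists:
  fixes \<gamma> \<delta> :: real
  assumes "\<gamma> > 1" "\<delta> > 0"
  obtains W where
    "\<And>x. (W has_real_derivative - (max \<delta> x powr (- \<gamma>))) (at x)"
    "\<And>x. \<delta> \<le> x \<Longrightarrow> W x = x powr (1 - \<gamma>) / (\<gamma> - 1)"
    "\<And>x. x \<le> \<delta> \<Longrightarrow> W x \<ge> \<delta> powr (1 - \<gamma>) / (\<gamma> - 1)"
    "\<And>x. W x \<ge> 0"
proof -
  let ?p = "\<lambda>x. x powr (1 - \<gamma>) / (\<gamma> - 1)"
  have "continuous_on UNIV (\<lambda>x. - (max \<delta> x powr (- \<gamma>)))"
    using assms by (intro continuous_intros) (auto simp: max_def)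
  then obtain W0 where W0: "\<And>x. (W0 has_real_derivative - (max \<delta> x powr (- \<gamma>))) (at x)"
    using continuous_has_antiderivative has_real_derivative_iff_has_vector_derivative by metis
  define W where "W x = W0 x + (?p \<delta> - W0 \<delta>)" for x
  have W: "(W has_real_derivative - (max \<delta> x powr (- \<gamma>))) (at x)" for x
    unfolding W_def[abs_def] using DERIV_add[OF W0 DERIV_const] by simp
  have W1: "W x = ?p x" if "\<delta> \<le> x" for x
  proof -
    have p: "(?p has_real_derivative - (y powr (- \<gamma>))) (at y)" if "y \<ge> \<delta>" for y
    proof -
      have "(?p has_real_derivative (1 - \<gamma>) * y powr (- \<gamma>) / (\<gamma> - 1)) (at y)"
        using DERIV_cdivide[OF has_real_derivative_powr[of y "1 - \<gamma>"], of "\<gamma> - 1"] that assms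
        by simp
      moreover have "(1 - \<gamma>) * z / (\<gamma> - 1) = - z" for z
        using assms by (simp add: field_simps)
      ultimately show ?thesis by simp
    qed
    have "(\<lambda>y. W y - ?p y) x = (\<lambda>y. W y - ?p y) \<delta>"
    proof (cases "x = \<delta>")
      case False
      then have "\<delta> < x" using that by simp
      moreover have d: "((\<lambda>y. W y - ?p y) has_real_derivative 0) (at y)" if "y \<ge> \<delta>" for y
        using DERIV_diff[OF W p[OF that]] that by (simp add: max_absorb2)
      ultimately show ?thesis
        by (intro DERIV_isconst_end) (auto intro!: continuous_at_imp_continuous_on DERIV_isCont[OF d])
    qed simp
    then show ?thesis by (simp add: W_def)
  qed
  have W2: "W x \<ge> ?p \<delta>" if "x \<le> \<delta>" for x
  proof -
    have "W \<delta> \<le> W x"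
    proof (rule DERIV_nonpos_imp_nonincreasing[OF that])
      show "\<exists>y. (W has_real_derivative y) (at z) \<and> y \<le> 0" for z
        using W by (intro exI[of _ "- (max \<delta> z powr (- \<gamma>))"]) simp
    qed
    then show ?thesis using W1[of \<delta>] by simp
  qed
  have "?p y \<ge> 0" for y using assms by simp
  then have W3: "W x \<ge> 0" for x
    using W1[of x] W2[of x] by (metis linear order_trans)
  show thesis by (rule that[OF W W1 W2 W3])
qed

lemma norm_diff_le_of_deriv_bound:
  fixes u :: "real \<Rightarrow> 'a::real_normed_vector"
  assumes "a \<le> b" "\<And>t. (u has_vector_derivative u' t) (at t)"
    "\<And>t. a < t \<Longrightarrow> t < b \<Longrightarrow> norm (u' t) \<le> c"
  shows "norm (u b - u a) \<le> c * (b - a)"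
proof (cases "a = b")
  case False
  then have "a < b" using assms by simp
  then have "norm (u b - u a) \<le> c * b - c * a"
  proof (rule differentiable_bound_general[where f'=u' and \<phi>'="\<lambda>_. c"])
    show "continuous_on {a..b} u"
      using assms(2) by (auto intro!: continuous_at_imp_continuous_on has_vector_derivative_continuous)
    show "((\<lambda>t. c * t) has_vector_derivative c) (at t)" for t
      using DERIV_cmult[OF DERIV_ident, of c] by (simp add: has_real_derivative_iff_has_vector_derivative)
  qed (use assms in \<open>auto intro!: continuous_intros\<close>)
  then show ?thesis by (simp add: algebra_simps)
qed simp

text \<open>
  The initial value problem at time T, solved backwards, is turned into a problem with data at
  infinity: the unknown is the correction D to the curve S, and the equation for D is damped to
  zero between T and T + 1.  Its solution vanishes on [T, \<infinity>) by uniqueness, so S + D continues S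
  to the past without any gluing of curves at T.
\<close>
lemma past_extension_of_cut_equation:
  fixes S :: "real \<Rightarrow> real^3^3"
  assumes "\<gamma> > 0" "\<delta> > 0"
    and S: "\<And>t. (S has_vector_derivative S' t) (at t)"
      "\<And>t. (S' has_vector_derivative S'' t) (at t)" "continuous_on UNIV S''"
    and R: "continuous_on UNIV R" "\<And>t. R t > 0" "norm (S T) \<le> R T"
    and match: "S'' T = force \<gamma> (S T)" "\<delta> \<le> det (S T)"
  obtains A A' A'' where "\<And>t. (A has_vector_derivative A' t) (at t)"
    "\<And>t. (A' has_vector_derivative A'' t) (at t)"
    "\<And>t. t \<ge> T \<Longrightarrow> A t = S t \<and> A' t = S' t \<and> A'' t = S'' t"
    "\<And>t. t \<le> T \<Longrightarrow> A'' t = cut_force \<gamma> \<delta> (clip (R t) (A t))"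
proof -
  have Scont: "continuous_on UNIV S"
    using S(1) by (auto intro!: continuous_at_imp_continuous_on has_vector_derivative_continuous)
  obtain C where C: "C \<ge> 0" "\<And>R X Y. norm X \<le> R \<Longrightarrow> norm Y \<le> R \<Longrightarrow>
      norm (cut_force \<gamma> \<delta> X - cut_force \<gamma> \<delta> Y) \<le> C * (R + R ^ 4) * norm (X - Y)"
    using cut_force_lipschitz[OF assms(2,1)] by blast
  \<comment> \<open>Freezing time at T keeps the right-hand side continuous there; the factor \<theta> is 1 up to
    time T and 0 from time T + 1 on, which makes the Lipschitz bound vanish near infinity.\<close>
  define \<tau> where "\<tau> t = min t T" for t
  define \<theta> where "\<theta> t = max 0 (1 - max 0 (t - T))" for t
  define G where "G t x = cut_force \<gamma> \<delta> (clip (R (\<tau> t)) (S (\<tau> t) + \<theta> t *\<^sub>R x)) - S'' (\<tau> t)" for t x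
  define L where "L t = 2 * C * (R (\<tau> t) + R (\<tau> t) ^ 4) * \<theta> t" for t
  define \<kappa> where "\<kappa> t = L t + norm (G t 0)" for t
  have \<theta>0: "\<theta> t \<ge> 0" for t by (simp add: \<theta>_def)
  have L0: "L t \<ge> 0" for t
    unfolding L_def using C(1) R(2)[of "\<tau> t"] \<theta>0 by (intro mult_nonneg_nonneg add_nonneg_nonneg) auto
  have cS: "continuous_on s (\<lambda>x. S (g x))" and cR: "continuous_on s (\<lambda>x. R (g x))"
    and cS'': "continuous_on s (\<lambda>x. S'' (g x))" if "continuous_on s g" for g :: "'b::topological_space \<Rightarrow> real" and s
    using continuous_on_compose2[OF Scont that] continuous_on_compose2[OF R(1) that]
      continuous_on_compose2[OF S(3) that] by auto
  have c\<tau>: "continuous_on s (\<lambda>x. \<tau> (g x))" and c\<theta>: "continuous_on s (\<lambda>x. \<theta> (g x))"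
    if "continuous_on s g" for g :: "'b::topological_space \<Rightarrow> real" and s
    unfolding \<tau>_def \<theta>_def by (intro continuous_intros that)+
  have cG: "continuous_on UNIV (\<lambda>p. G (fst p) (snd p))"
    unfolding G_def using R(2)
    by (intro continuous_on_diff continuous_on_cut_force[OF assms(2)] continuous_on_clip
        continuous_on_add continuous_on_scaleR cR cS cS'' c\<tau> c\<theta> continuous_on_fst continuous_on_snd
        continuous_on_id) auto
  have cG0: "continuous_on UNIV (\<lambda>t. G t 0)"
    using continuous_on_compose2[OF cG continuous_on_Pair[OF continuous_on_id continuous_on_const]] by simp
  have c\<kappa>: "continuous_on UNIV \<kappa>"
    unfolding \<kappa>_def[abs_def] L_def[abs_def]
    by (intro continuous_intros cR c\<tau> c\<theta> cG0)
  have lip: "norm (G t x - G t y) \<le> L t * norm (x - y)" for t x y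
  proof -
    let ?c = "\<lambda>x. clip (R (\<tau> t)) (S (\<tau> t) + \<theta> t *\<^sub>R x)"
    have "norm (G t x - G t y) = norm (cut_force \<gamma> \<delta> (?c x) - cut_force \<gamma> \<delta> (?c y))"
      by (simp add: G_def)
    also have "\<dots> \<le> C * (R (\<tau> t) + R (\<tau> t) ^ 4) * norm (?c x - ?c y)"
      by (intro C(2) norm_clip_le R(2))
    also have "\<dots> \<le> C * (R (\<tau> t) + R (\<tau> t) ^ 4)
        * (2 * norm ((S (\<tau> t) + \<theta> t *\<^sub>R x) - (S (\<tau> t) + \<theta> t *\<^sub>R y)))"
      using C(1) R(2)[of "\<tau> t"] by (intro mult_left_mono clip_lipschitz R(2)) auto
    also have "norm ((S (\<tau> t) + \<theta> t *\<^sub>R x) - (S (\<tau> t) + \<theta> t *\<^sub>R y)) = \<theta> t * norm (x - y)"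
      using \<theta>0[of t] by (simp flip: scaleR_diff_right)
    finally show ?thesis by (simp add: L_def algebra_simps)
  qed
  have G0: "G t 0 = 0" if "t \<ge> T" for t
    using that R(2)[of T] R(3) match
    by (simp add: G_def \<tau>_def min_absorb2 clip_eq cut_force_eq_force)
  have \<kappa>0: "\<kappa> t = 0" if "t \<ge> T + 1" for t
    using that G0[of t] by (simp add: \<kappa>_def L_def \<theta>_def)
  have \<kappa>pos: "0 \<le> \<kappa> t" for t using L0[of t] by (simp add: \<kappa>_def)
  have \<kappa>dec: "\<kappa> t \<le> 0 * t powr (- 1 - 2)" if "t \<ge> max (T + 1) 1" for t using \<kappa>0[of t] that by simp
  have lip': "norm (G t x - G t y) \<le> \<kappa> t * norm (x - y)" for t x y
  proof -
    have "L t * norm (x - y) \<le> \<kappa> t * norm (x - y)" by (intro mult_right_mono) (auto simp: \<kappa>_def)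
    then show ?thesis using lip[of t x y] by linarith
  qed
  have G0': "norm (G t 0) \<le> \<kappa> t" for t using L0[of t] by (simp add: \<kappa>_def)
  have pos: "(0::real) < max (T + 1) 1" "(0::real) < 1" by auto
  obtain D D' where D: "\<And>t. (D has_vector_derivative D' t) (at t)"
    "\<And>t. (D' has_vector_derivative G t (D t)) (at t)" "(D \<longlongrightarrow> 0) at_top"
    by (rule second_order_solution_from_infinity[OF c\<kappa> \<kappa>pos \<kappa>dec pos cG lip' G0'], assumption, rule that)
  have "continuous_on UNIV D"
    using D(1) by (auto intro!: continuous_at_imp_continuous_on has_vector_derivative_continuous)
  then have cGD: "continuous_on UNIV (\<lambda>t. G t (D t))"
    using continuous_on_compose2[OF cG continuous_on_Pair[OF continuous_on_id]] by simp
  have le: "norm (G t (D t)) \<le> \<kappa> t * norm (D t)" if "t \<ge> T" for t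
    using lip'[of t "D t" 0] G0[OF that] by simp
  have D0: "D t = 0" "D' t = 0" if "t \<ge> T" for t
    using second_order_unique_from_infinity[OF c\<kappa> \<kappa>pos \<kappa>dec pos D(1,2) cGD D(3) le that] by auto
  show thesis
  proof (rule that)
    show "((\<lambda>t. S t + D t) has_vector_derivative S' t + D' t) (at t)" for t
      by (rule has_vector_derivative_add[OF S(1) D(1)])
    show "((\<lambda>t. S' t + D' t) has_vector_derivative S'' t + G t (D t)) (at t)" for t
      by (rule has_vector_derivative_add[OF S(2) D(2)])
    show "S t + D t = S t \<and> S' t + D' t = S' t \<and> S'' t + G t (D t) = S'' t" if "T \<le> t" for t
      using D0[OF that] G0[OF that] by simp
    show "S'' t + G t (D t) = cut_force \<gamma> \<delta> (clip (R t) (S t + D t))" if "t \<le> T" for t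
      using that by (simp add: G_def \<tau>_def \<theta>_def min_absorb1)
  qed
qed

text \<open>
  The energy at time T determines the cut level \<delta>, chosen so that the potential there is the
  energy plus 1, and a bound c for the speed.  As the cut potential is nonnegative, a motion of this
  energy moves with speed at most c, so it never leaves the ball of radius R (t); and its
  determinant never falls to \<delta>.  Both cutoffs are thus inactive and the cut equation is the
  original one.
\<close>
lemma extend_solution_to_past:
  fixes S :: "real \<Rightarrow> real^3^3"
  assumes "\<gamma> > 1"
    and S: "\<And>t. (S has_vector_derivative S' t) (at t)"
      "\<And>t. (S' has_vector_derivative S'' t) (at t)" "continuous_on UNIV S''"
    and sol: "\<And>t. t \<ge> T \<Longrightarrow> det (S t) > 0 \<and> S'' t = force \<gamma> (S t)"
  obtains A where "global_solution \<gamma> A" "\<And>t. t \<ge> T \<Longrightarrow> A t = S t"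
proof -
  have \<gamma>: "\<gamma> > 0" using assms by simp
  define p where "p x = x powr (1 - \<gamma>) / (\<gamma> - 1)" for x
  define E where "E = inner (S' T) (S' T) / 2 + p (det (S T))"
  have E0: "E \<ge> 0" using assms(1) by (simp add: E_def p_def)
  define \<delta> where "\<delta> = ((\<gamma> - 1) * (E + 1)) powr (1 / (1 - \<gamma>))"
  have \<delta>: "\<delta> > 0" using assms E0 by (simp add: \<delta>_def)
  have p\<delta>: "p \<delta> = E + 1" using assms E0 by (simp add: \<delta>_def p_def powr_powr)
  have dT: "det (S T) > 0" using sol by simp
  have \<delta>T: "\<delta> \<le> det (S T)"
  proof (rule ccontr)
    assume "\<not> \<delta> \<le> det (S T)"
    then have "\<delta> powr (1 - \<gamma>) \<le> det (S T) powr (1 - \<gamma>)"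
      using dT assms by (intro powr_mono2') auto
    then have "p \<delta> \<le> p (det (S T))" using assms unfolding p_def by (intro divide_right_mono) auto
    moreover have "p (det (S T)) \<le> E" using inner_ge_zero[of "S' T"] by (simp add: E_def)
    ultimately show False using p\<delta> by linarith
  qed
  define c where "c = sqrt (2 * E)"
  define R where "R t = norm (S T) + 1 + c * \<bar>T - t\<bar>" for t
  have c0: "c \<ge> 0" using E0 by (simp add: c_def)
  have R: "continuous_on UNIV R" "\<And>t. R t > 0" "norm (S T) \<le> R T"
  proof -
    show "continuous_on UNIV R" unfolding R_def by (intro continuous_intros)
    have "0 \<le> c * \<bar>T - t\<bar>" for t using c0 by simp
    then show "R t > 0" for t
      unfolding R_def using norm_ge_zero[of "S T"] by (smt (verit))
  qed (simp add: R_def)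
  obtain W where W: "\<And>x. (W has_real_derivative - (max \<delta> x powr (- \<gamma>))) (at x)"
    "\<And>x. \<delta> \<le> x \<Longrightarrow> W x = p x" "\<And>x. x \<le> \<delta> \<Longrightarrow> W x \<ge> p \<delta>" "\<And>x. W x \<ge> 0"
    by (rule cut_potential_exists[OF assms(1) \<delta>, folded p_def]) (rule that)
  have ST: "S'' T = force \<gamma> (S T)" using sol by simp
  obtain A A' A'' where A: "\<And>t. (A has_vector_derivative A' t) (at t)"
    "\<And>t. (A' has_vector_derivative A'' t) (at t)"
    "\<And>t. t \<ge> T \<Longrightarrow> A t = S t \<and> A' t = S' t \<and> A'' t = S'' t"
    "\<And>t. t \<le> T \<Longrightarrow> A'' t = cut_force \<gamma> \<delta> (clip (R t) (A t))"
    by (rule past_extension_of_cut_equation[OF \<gamma> \<delta> S R ST \<delta>T]) (rule that)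
  have cA: "continuous_on s A" "continuous_on s A'" for s
    using A(1,2) by (auto intro!: continuous_at_imp_continuous_on has_vector_derivative_continuous)
  define e where "e t = inner (A' t) (A' t) / 2 + W (det (A t))" for t
  have eT: "e T = E" using A(3)[of T] W(2)[OF \<delta>T] by (simp add: e_def E_def)
  have de: "(e has_real_derivative 0) (at t)" if "t \<le> T" "norm (A t) \<le> R t" for t
  proof -
    have "A'' t = cut_force \<gamma> \<delta> (A t)" using A(4) that R(2) by (simp add: clip_eq)
    then have A'': "inner (A' t) (A'' t) = max \<delta> (det (A t)) powr (- \<gamma>) * inner (cof (A t)) (A' t)"
      by (simp add: cut_force_def inner_commute)
    have "((\<lambda>t. inner (A' t) (A' t)) has_real_derivative 2 * inner (A' t) (A'' t)) (at t)"
      using bounded_bilinear.has_vector_derivative[OF bounded_bilinear_inner A(2) A(2), of t]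
      by (simp add: has_real_derivative_iff_has_vector_derivative inner_commute)
    then have 1: "((\<lambda>t. inner (A' t) (A' t) / 2) has_real_derivative inner (A' t) (A'' t)) (at t)"
      using DERIV_cdivide[of _ "2 * inner (A' t) (A'' t)" _ _ 2] by simp
    have 2: "((\<lambda>t. W (det (A t))) has_real_derivative
        - (max \<delta> (det (A t)) powr (- \<gamma>)) * inner (cof (A t)) (A' t)) (at t)"
      by (rule DERIV_chain2[OF W(1) det_has_derivative[OF A(1)]])
    show ?thesis
      unfolding e_def[abs_def] using DERIV_add[OF 1 2] by (simp add: A'')
  qed
  have ce: "continuous_on s e" for s
  proof -
    have "continuous_on UNIV W" using W(1) by (auto intro!: continuous_at_imp_continuous_on DERIV_isCont)
    then have "continuous_on s (\<lambda>t. W (det (A t)))"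
      by (rule continuous_on_compose2[OF _ continuous_on_det3[OF cA(1)]]) auto
    then show ?thesis unfolding e_def[abs_def] by (intro continuous_intros cA) auto
  qed
  have e_const: "e s = E" if sT: "s \<le> T" and above: "\<And>t. s < t \<Longrightarrow> t \<le> T \<Longrightarrow> norm (A t) < R t" for s
  proof (cases "s = T")
    case False
    have "e T = e s"
    proof (rule DERIV_isconst_end[OF _ ce])
      show "s < T" using False sT by simp
      fix t assume t: "s < t" "t < T"
      show "(e has_real_derivative 0) (at t)"
        by (rule de) (use t above[of t] in auto)
    qed
    then show ?thesis using eT by simp
  qed (use eT in simp)
  \<comment> \<open>At the last time s when the radius R is reached, conservation on [s, T] already gives the
    speed bound, and the extra 1 in R contradicts it.\<close>
  have inside: "norm (A t) < R t" if "t \<le> T" for t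
  proof (rule ccontr)
    assume neg: "\<not> norm (A t) < R t"
    define B where "B = {t..T} \<inter> {s. R s \<le> norm (A s)}"
    have "closed {s. R s \<le> norm (A s)}"
      by (rule closed_Collect_le[OF R(1) continuous_on_norm[OF cA(1)]])
    then have "compact B" unfolding B_def by (rule compact_Int_closed[OF compact_Icc])
    moreover have "B \<noteq> {}" using neg that by (auto simp: B_def)
    ultimately obtain s where s: "s \<in> B" "\<And>r. r \<in> B \<Longrightarrow> r \<le> s"
      using compact_attains_sup[of B] by metis
    have in': "norm (A r) < R r" if "s < r" "r \<le> T" for r
      using s(1) s(2)[of r] that by (force simp: B_def)
    have "norm (A T - A s) \<le> c * (T - s)"
    proof (rule norm_diff_le_of_deriv_bound[OF _ A(1)])
      show "s \<le> T" using s(1) by (simp add: B_def)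
      fix r assume r: "s < r" "r < T"
      then have "e r = E" using in' by (intro e_const) auto
      then have "inner (A' r) (A' r) \<le> 2 * E" unfolding e_def using W(4)[of "det (A r)"] by linarith
      then show "norm (A' r) \<le> c" by (simp add: c_def norm_eq_sqrt_inner)
    qed
    moreover have "norm (A s) \<le> norm (A T) + norm (A T - A s)"
      using norm_triangle_ineq2[of "A s" "A T"] by (simp add: norm_minus_commute)
    ultimately have "norm (A s) < R s" using A(3)[of T] s(1) by (simp add: R_def B_def)
    then show False using s(1) by (simp add: B_def)
  qed
  have past: "\<delta> < det (A t)" "A'' t = force \<gamma> (A t)" if "t \<le> T" for t
  proof -
    have "e t = E" using inside that by (intro e_const) auto
    then have "W (det (A t)) \<le> E" unfolding e_def using inner_ge_zero[of "A' t"] by linarith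
    then show "\<delta> < det (A t)" using W(3)[of "det (A t)"] p\<delta> by linarith
    then show "A'' t = force \<gamma> (A t)"
      using A(4)[OF that] inside[OF that] R(2)[of t] by (simp add: clip_eq cut_force_eq_force)
  qed
  have all: "det (A t) > 0" "A'' t = force \<gamma> (A t)" for t
  proof -
    show "det (A t) > 0"
      using past(1)[of t] \<delta> A(3)[of t] sol[of t] by (cases "t \<le> T") auto
    show "A'' t = force \<gamma> (A t)"
      using past(2)[of t] A(3)[of t] sol[of t] by (cases "t \<le> T") auto
  qed
  have "global_solution \<gamma> A"
    unfolding global_solution_iff
  proof (intro exI[of _ A'] conjI allI)
    show "(A' has_vector_derivative force \<gamma> (A t)) (at t)" for t
      using A(2)[of t] all(2)[of t] by simp
  qed (use A(1) all(1) in auto)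
  then show thesis by (rule that) (simp add: A(3))
qed

section \<open>The force near a given matrix\<close>

lemma norm_transpose: "norm (transpose X) = norm (X :: real^'n^'m)"
proof -
  have "inner (transpose X) (transpose X) = inner X X"
    unfolding inner_vec_def transpose_def
    by (simp, rule sum.swap)
  then show ?thesis by (simp add: norm_eq_sqrt_inner)
qed

text \<open>
  On a small ball around the identity the determinant is at least 1/2, so that the force equals
  the cut force and inherits its Lipschitz bound.
\<close>
lemma force_lipschitz_at_identity:
  assumes "\<gamma> > 0"
  obtains r L where "r > 0" "L > 0"
    "\<And>Z :: real^3^3. norm Z \<le> r \<Longrightarrow> det (mat 1 + Z) > 0"
    "\<And>Z. norm Z \<le> r \<Longrightarrow> norm (force \<gamma> (mat 1 + Z)) \<le> L"
    "\<And>Z Z'. norm Z \<le> r \<Longrightarrow> norm Z' \<le> r \<Longrightarrow>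
      norm (force \<gamma> (mat 1 + Z) - force \<gamma> (mat 1 + Z')) \<le> L * norm (Z - Z')"
proof -
  obtain K where K: "K > 0" "\<And>(X::real^3^3) Y R. norm X \<le> R \<Longrightarrow> norm Y \<le> R \<Longrightarrow>
      \<bar>det X - det Y\<bar> \<le> K * R\<^sup>2 * norm (X - Y)"
    using cof_det_lipschitz by metis
  define R where "R = norm (mat 1 :: real^3^3) + 1"
  have R: "R \<ge> 1" by (simp add: R_def)
  obtain C where C: "C \<ge> 0" "\<And>R X Y. norm X \<le> R \<Longrightarrow> norm Y \<le> R \<Longrightarrow>
      norm (cut_force \<gamma> (1/2) X - cut_force \<gamma> (1/2) Y) \<le> C * (R + R ^ 4) * norm (X - Y)"
    using cut_force_lipschitz[of "1/2", OF _ assms] by auto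
  define r where "r = min 1 (1 / (2 * K * R\<^sup>2))"
  have r: "r > 0" "r \<le> 1" using K(1) R by (auto simp: r_def)
  have KR: "K * R\<^sup>2 * r \<le> 1 / 2"
  proof -
    have "K * R\<^sup>2 * r \<le> K * R\<^sup>2 * (1 / (2 * K * R\<^sup>2))"
      using K(1) by (intro mult_left_mono) (auto simp: r_def)
    also have "\<dots> = 1 / 2" using K(1) R by simp
    finally show ?thesis .
  qed
  have near: "norm (mat 1 + Z) \<le> R" if "norm Z \<le> r" for Z :: "real^3^3"
    using norm_triangle_ineq[of "mat 1" Z] that r(2) by (simp add: R_def)
  have half: "1 / 2 \<le> det (mat 1 + Z)" if "norm Z \<le> r" for Z :: "real^3^3"
  proof -
    have "\<bar>det (mat 1 + Z) - det (mat 1 :: real^3^3)\<bar> \<le> K * R\<^sup>2 * norm ((mat 1 + Z) - mat 1)"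
      by (rule K(2)[OF near[OF that]]) (simp add: R_def)
    also have "\<dots> \<le> K * R\<^sup>2 * r" using that K(1) by (intro mult_left_mono) auto
    finally have "\<bar>det (mat 1 + Z) - 1\<bar> \<le> 1 / 2" using KR by simp
    then show ?thesis by linarith
  qed
  define L0 where "L0 = C * (R + R ^ 4)"
  have L0: "L0 \<ge> 0" using C(1) R by (simp add: L0_def)
  have lip: "norm (force \<gamma> (mat 1 + Z) - force \<gamma> (mat 1 + Z')) \<le> L0 * norm (Z - Z')"
    if "norm Z \<le> r" "norm Z' \<le> r" for Z Z'
    using C(2)[OF near[OF that(1)] near[OF that(2)]] half[OF that(1)] half[OF that(2)]
    by (simp add: cut_force_eq_force L0_def)
  define F where "F = norm (force \<gamma> (mat 1))"
  show thesis
  proof (rule that[of r "L0 + F + 1"])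
    show "0 < L0 + F + 1" using L0 by (simp add: F_def add_nonneg_pos)
    show "det (mat 1 + Z) > 0" if "norm Z \<le> r" for Z :: "real^3^3" using half[OF that] by linarith
    show "norm (force \<gamma> (mat 1 + Z)) \<le> L0 + F + 1" if "norm Z \<le> r" for Z
    proof -
      have "norm (force \<gamma> (mat 1 + Z) - force \<gamma> (mat 1 + 0)) \<le> L0 * norm (Z - 0)"
        using that r(1) by (intro lip) auto
      also have "\<dots> \<le> L0 * 1" using that r(2) L0 by (intro mult_left_mono) auto
      finally have "norm (force \<gamma> (mat 1 + Z) - force \<gamma> (mat 1)) \<le> L0" by simp
      then show ?thesis
        using norm_triangle_ineq2[of "force \<gamma> (mat 1 + Z)" "force \<gamma> (mat 1)"] by (simp add: F_def)
    qed
    show "norm (force \<gamma> (mat 1 + Z) - force \<gamma> (mat 1 + Z')) \<le> (L0 + F + 1) * norm (Z - Z')"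
      if "norm Z \<le> r" "norm Z' \<le> r" for Z Z'
    proof -
      have "L0 * norm (Z - Z') \<le> (L0 + F + 1) * norm (Z - Z')"
        by (intro mult_right_mono) (auto simp: F_def)
      then show ?thesis using lip[OF that] by linarith
    qed
  qed (rule r)
qed

text \<open>
  Writing M + X = M (1 + Z) with Z the inverse of M times X, equivariance reduces the
  claim to a ball around the identity.  The perturbation has to be small relative to the inverse of M, and each difference
  X - Y costs one further factor of that inverse.
\<close>
lemma force_relative_perturbation:
  assumes "\<gamma> > 0"
  obtains r K where "r > 0" "K > 0"
    "\<And>M X :: real^3^3. det M > 0 \<Longrightarrow> norm (matrix_inv M) * norm X \<le> r \<Longrightarrow>
      det (M + X) > 0 \<and> norm (force \<gamma> (M + X)) \<le> K * (det M powr (1 - \<gamma>) * norm (matrix_inv M))"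
    "\<And>M X Y :: real^3^3. det M > 0 \<Longrightarrow> norm (matrix_inv M) * norm X \<le> r \<Longrightarrow> norm (matrix_inv M) * norm Y \<le> r \<Longrightarrow>
      norm (force \<gamma> (M + X) - force \<gamma> (M + Y))
        \<le> K * (det M powr (1 - \<gamma>) * norm (matrix_inv M)) * (norm (matrix_inv M) * norm (X - Y))"
proof -
  obtain r L where L: "r > 0" "L > 0"
    "\<And>Z :: real^3^3. norm Z \<le> r \<Longrightarrow> det (mat 1 + Z) > 0"
    "\<And>Z. norm Z \<le> r \<Longrightarrow> norm (force \<gamma> (mat 1 + Z)) \<le> L"
    "\<And>Z Z'. norm Z \<le> r \<Longrightarrow> norm Z' \<le> r \<Longrightarrow>
      norm (force \<gamma> (mat 1 + Z) - force \<gamma> (mat 1 + Z')) \<le> L * norm (Z - Z')"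
    using force_lipschitz_at_identity[OF assms] by metis
  interpret mm: bounded_bilinear "(**) :: real^3^3 \<Rightarrow> real^3^3 \<Rightarrow> real^3^3"
    by (rule bounded_bilinear_matrix_mult)
  obtain B where B: "B > 0" "\<And>(X::real^3^3) (Y::real^3^3). norm (X ** Y) \<le> norm X * norm Y * B"
    using mm.pos_bounded by blast
  have Z: "norm (matrix_inv M ** X) \<le> r" if "norm (matrix_inv M) * norm X \<le> r / B" for M X :: "real^3^3"
  proof -
    have "norm (matrix_inv M ** X) \<le> norm (matrix_inv M) * norm X * B" by (rule B)
    also have "\<dots> \<le> r / B * B" using that B(1) by (intro mult_right_mono) auto
    finally show ?thesis using B(1) by simp
  qed
  have MX: "M + X = M ** (mat 1 + matrix_inv M ** X)" if "det M > 0" for M X :: "real^3^3"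
  proof -
    have "M ** (matrix_inv M ** X) = X"
      using that by (simp add: matrix_mul_assoc matrix_inv_cof(2))
    then show ?thesis by (simp add: mm.add_right)
  qed
  have F: "force \<gamma> (M + X) = (det M powr (1 - \<gamma>)) *\<^sub>R
      (transpose (matrix_inv M) ** force \<gamma> (mat 1 + matrix_inv M ** X))"
    if "det M > 0" "norm (matrix_inv M) * norm X \<le> r / B" for M X
    unfolding MX[OF that(1)] by (rule force_mult[OF that(1) L(3)[OF Z[OF that(2)]]])
  define K where "K = max (L * B) (L * B * B)"
  have K: "L * B \<le> K" "L * B * B \<le> K" by (auto simp: K_def)
  show thesis
  proof (rule that[of "r / B" K])
    show "r / B > 0" using L B by simp
    show "K > 0" using L B by (simp add: K_def less_max_iff_disj)
  next
    fix M X :: "real^3^3" assume M: "det M > 0" and X: "norm (matrix_inv M) * norm X \<le> r / B"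
    let ?N = "norm (matrix_inv M)" and ?d = "det M powr (1 - \<gamma>)"
    have "det (M + X) > 0"
      unfolding MX[OF M] using M L(3)[OF Z[OF X]] by (simp add: det_mul)
    moreover have "norm (force \<gamma> (M + X)) \<le> K * (?d * ?N)"
    proof -
      have "norm (force \<gamma> (M + X)) = ?d * norm (transpose (matrix_inv M) ** force \<gamma> (mat 1 + matrix_inv M ** X))"
        by (simp add: F[OF M X])
      also have "\<dots> \<le> ?d * (norm (transpose (matrix_inv M)) * norm (force \<gamma> (mat 1 + matrix_inv M ** X)) * B)"
        by (intro mult_left_mono B) auto
      also have "\<dots> \<le> ?d * (?N * L * B)"
        unfolding norm_transpose using B(1) by (intro mult_left_mono mult_right_mono L(4) Z X) auto
      also have "\<dots> = (L * B) * (?d * ?N)" by simp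
      also have "\<dots> \<le> K * (?d * ?N)" using K by (intro mult_right_mono) auto
      finally show ?thesis .
    qed
    ultimately show "det (M + X) > 0 \<and> norm (force \<gamma> (M + X)) \<le> K * (?d * ?N)" by blast
  next
    fix M X Y :: "real^3^3"
    assume M: "det M > 0" and X: "norm (matrix_inv M) * norm X \<le> r / B"
      and Y: "norm (matrix_inv M) * norm Y \<le> r / B"
    let ?N = "norm (matrix_inv M)" and ?d = "det M powr (1 - \<gamma>)"
    let ?ZX = "matrix_inv M ** X" and ?ZY = "matrix_inv M ** Y"
    have "norm (force \<gamma> (M + X) - force \<gamma> (M + Y)) =
        ?d * norm (transpose (matrix_inv M) ** (force \<gamma> (mat 1 + ?ZX) - force \<gamma> (mat 1 + ?ZY)))"
      by (simp add: F[OF M X] F[OF M Y] mm.diff_right flip: scaleR_diff_right)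
    also have "\<dots> \<le> ?d * (norm (transpose (matrix_inv M)) * norm (force \<gamma> (mat 1 + ?ZX) - force \<gamma> (mat 1 + ?ZY)) * B)"
      by (intro mult_left_mono B) auto
    also have "\<dots> \<le> ?d * (?N * (L * norm (?ZX - ?ZY)) * B)"
      unfolding norm_transpose using B(1)
      by (intro mult_left_mono mult_right_mono L(5) Z X Y) auto
    also have "\<dots> \<le> ?d * (?N * (L * (?N * norm (X - Y) * B)) * B)"
      using B(1) L(2) B(2)[of "matrix_inv M" "X - Y"]
      by (intro mult_left_mono mult_right_mono) (auto simp: mm.diff_right)
    also have "\<dots> = (L * B * B) * (?d * ?N * (?N * norm (X - Y)))" by simp
    also have "\<dots> \<le> K * (?d * ?N * (?N * norm (X - Y)))"
      using K by (intro mult_right_mono) auto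
    finally show "norm (force \<gamma> (M + X) - force \<gamma> (M + Y)) \<le> K * (?d * ?N) * (?N * norm (X - Y))"
      by (simp add: mult.assoc)
  qed
qed

section \<open>Solutions asymptotic to a free motion\<close>

text \<open>
  A single setting for both cases of the theorem.  The exponent b is 0 when the inverse of the
  free motion stays bounded and 1 when it grows linearly: closeness of order t^(-b) is exactly
  what keeps a perturbation small relative to the inverse, and \<mu> > b is what makes the
  corrections, of order t^(-\<mu>), negligible on that scale.
\<close>
locale free_motion =
  fixes \<gamma> d \<alpha> b \<mu> T0 c C1 :: real and A0 A1 :: "real^3^3"
  assumes gamma: "\<gamma> > 1" and T0: "T0 \<ge> 1" and c: "c > 0" and C1: "C1 > 0"
    and det_ge: "\<And>t. t \<ge> T0 \<Longrightarrow> c * t powr d \<le> det (A_infty A0 A1 t)"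
    and inv_le: "\<And>t. t \<ge> T0 \<Longrightarrow> norm (matrix_inv (A_infty A0 A1 t)) \<le> C1 * t powr \<alpha>"
    and mu: "\<mu> = d * (\<gamma> - 1) - \<alpha> - 2"
    and b: "b \<ge> \<alpha>" "b \<ge> 0" "\<mu> > b"
begin

abbreviation "M \<equiv> A_infty A0 A1"

definition asymptotic :: "(real \<Rightarrow> real^3^3) \<Rightarrow> bool" where
  "asymptotic A \<longleftrightarrow> ((\<lambda>t. t powr b * norm (A t - M t)) \<longlongrightarrow> 0) at_top"

lemma M_deriv: "(M has_vector_derivative A1) (at t)"
proof -
  have "((\<lambda>t. A0 + t *\<^sub>R A1) has_vector_derivative 0 + 1 *\<^sub>R A1) (at t)"
    using has_vector_derivative_add[OF has_vector_derivative_const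
        has_vector_derivative_scaleR[OF DERIV_ident has_vector_derivative_const]] by fastforce
  then show ?thesis by (simp add: A_infty_def[abs_def])
qed

lemma det_M_pos: "t \<ge> T0 \<Longrightarrow> det (M t) > 0"
  using det_ge[of t] c T0 by (smt (verit) mult_pos_pos powr_gt_zero)

text \<open>
  The exponents add up: det^(1 - \<gamma>) contributes d (1 - \<gamma>), the inverse contributes \<alpha>, and the sum
  is - \<mu> - 2.  The further factor of the inverse in the Lipschitz bound is weakened from
  exponent \<alpha> to b, and \<mu> - b > 0 still makes t times this bound integrable at infinity.
\<close>
lemma force_near_free_motion:
  obtains \<epsilon> K where "\<epsilon> > 0" "K > 0"
    "\<And>t X. t \<ge> T0 \<Longrightarrow> norm X \<le> \<epsilon> * t powr (- b) \<Longrightarrow>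
      det (M t + X) > 0 \<and> norm (force \<gamma> (M t + X)) \<le> K * t powr (- \<mu> - 2)"
    "\<And>t X Y. t \<ge> T0 \<Longrightarrow> norm X \<le> \<epsilon> * t powr (- b) \<Longrightarrow> norm Y \<le> \<epsilon> * t powr (- b) \<Longrightarrow>
      norm (force \<gamma> (M t + X) - force \<gamma> (M t + Y)) \<le> K * t powr (- (\<mu> - b) - 2) * norm (X - Y)"
proof -
  have "\<gamma> > 0" using gamma by simp
  then obtain r K0 where K0: "r > 0" "K0 > 0"
    "\<And>M X :: real^3^3. det M > 0 \<Longrightarrow> norm (matrix_inv M) * norm X \<le> r \<Longrightarrow>
      det (M + X) > 0 \<and> norm (force \<gamma> (M + X)) \<le> K0 * (det M powr (1 - \<gamma>) * norm (matrix_inv M))"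
    "\<And>M X Y :: real^3^3. det M > 0 \<Longrightarrow> norm (matrix_inv M) * norm X \<le> r \<Longrightarrow> norm (matrix_inv M) * norm Y \<le> r \<Longrightarrow>
      norm (force \<gamma> (M + X) - force \<gamma> (M + Y))
        \<le> K0 * (det M powr (1 - \<gamma>) * norm (matrix_inv M)) * (norm (matrix_inv M) * norm (X - Y))"
    using force_relative_perturbation by metis
  define \<epsilon> where "\<epsilon> = r / C1"
  have \<epsilon>: "\<epsilon> > 0" using K0 C1 by (simp add: \<epsilon>_def)
  define K1 where "K1 = K0 * (c powr (1 - \<gamma>) * C1)"
  have K1: "K1 > 0" using K0 C1 c by (simp add: K1_def)
  define K where "K = max K1 (K1 * C1)"
  have inv_le_b: "norm (matrix_inv (M t)) \<le> C1 * t powr b" if "t \<ge> T0" for t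
  proof -
    have "C1 * t powr \<alpha> \<le> C1 * t powr b" using that T0 b C1 by (intro mult_left_mono powr_mono) auto
    then show ?thesis using inv_le[OF that] by linarith
  qed
  have small: "norm (matrix_inv (M t)) * norm X \<le> r" if "t \<ge> T0" "norm X \<le> \<epsilon> * t powr (- b)" for t and X :: "real^3^3"
  proof -
    have "norm (matrix_inv (M t)) * norm X \<le> (C1 * t powr b) * (\<epsilon> * t powr (- b))"
      using C1 by (intro mult_mono inv_le_b that) auto
    also have "\<dots> = r * (t powr b * t powr (- b))" using C1 by (simp add: \<epsilon>_def)
    also have "\<dots> = r" using that T0 by (simp flip: powr_add)
    finally show ?thesis .
  qed
  have size: "K0 * (det (M t) powr (1 - \<gamma>) * norm (matrix_inv (M t))) \<le> K1 * t powr (- \<mu> - 2)"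
    if "t \<ge> T0" for t
  proof -
    have t: "t > 0" using that T0 by simp
    have "det (M t) powr (1 - \<gamma>) \<le> (c * t powr d) powr (1 - \<gamma>)"
      using det_ge[OF that] gamma c t by (intro powr_mono2') auto
    also have "\<dots> = c powr (1 - \<gamma>) * t powr (d * (1 - \<gamma>))"
      using c by (simp add: powr_mult powr_powr)
    finally have "K0 * (det (M t) powr (1 - \<gamma>) * norm (matrix_inv (M t)))
        \<le> K0 * ((c powr (1 - \<gamma>) * t powr (d * (1 - \<gamma>))) * (C1 * t powr \<alpha>))"
      using K0(2) c by (intro mult_left_mono mult_mono inv_le that) auto
    also have "\<dots> = K1 * (t powr (d * (1 - \<gamma>)) * t powr \<alpha>)" by (simp add: K1_def)
    also have "t powr (d * (1 - \<gamma>)) * t powr \<alpha> = t powr (- \<mu> - 2)"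
      by (simp add: mu algebra_simps flip: powr_add)
    finally show ?thesis .
  qed
  show thesis
  proof (rule that[OF \<epsilon>, of K])
    show "K > 0" using K1 by (simp add: K_def less_max_iff_disj)
  next
    fix t and X :: "real^3^3" assume t: "t \<ge> T0" and X: "norm X \<le> \<epsilon> * t powr (- b)"
    have "K1 * t powr (- \<mu> - 2) \<le> K * t powr (- \<mu> - 2)" by (intro mult_right_mono) (auto simp: K_def)
    then show "det (M t + X) > 0 \<and> norm (force \<gamma> (M t + X)) \<le> K * t powr (- \<mu> - 2)"
      using K0(3)[OF det_M_pos[OF t] small[OF t X]] size[OF t] by linarith
  next
    fix t and X Y :: "real^3^3" assume t: "t \<ge> T0" and X: "norm X \<le> \<epsilon> * t powr (- b)" and Y: "norm Y \<le> \<epsilon> * t powr (- b)"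
    have "norm (force \<gamma> (M t + X) - force \<gamma> (M t + Y))
        \<le> K0 * (det (M t) powr (1 - \<gamma>) * norm (matrix_inv (M t))) * (norm (matrix_inv (M t)) * norm (X - Y))"
      by (rule K0(4)[OF det_M_pos[OF t] small[OF t X] small[OF t Y]])
    also have "\<dots> \<le> (K1 * t powr (- \<mu> - 2)) * ((C1 * t powr b) * norm (X - Y))"
      using C1 K1 by (intro mult_mono size inv_le_b t) auto
    also have "\<dots> = (K1 * C1) * ((t powr (- \<mu> - 2) * t powr b) * norm (X - Y))" by simp
    also have "\<dots> \<le> K * ((t powr (- \<mu> - 2) * t powr b) * norm (X - Y))"
      by (intro mult_right_mono) (auto simp: K_def)
    also have "t powr (- \<mu> - 2) * t powr b = t powr (- (\<mu> - b) - 2)"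
      by (simp add: algebra_simps flip: powr_add)
    finally show "norm (force \<gamma> (M t + X) - force \<gamma> (M t + Y)) \<le> K * t powr (- (\<mu> - b) - 2) * norm (X - Y)"
      by (simp add: mult.assoc)
  qed
qed

lemma asymptotic_imp_close:
  assumes "asymptotic A" "\<epsilon> > 0"
  obtains T where "T \<ge> T0" "\<And>t. t \<ge> T \<Longrightarrow> norm (A t - M t) \<le> \<epsilon> * t powr (- b)"
proof -
  have "\<forall>\<^sub>F t in at_top. dist (t powr b * norm (A t - M t)) 0 < \<epsilon>"
    using assms unfolding asymptotic_def by (intro tendstoD)
  then obtain N where N: "\<And>t. t \<ge> N \<Longrightarrow> t powr b * norm (A t - M t) < \<epsilon>"
    by (auto simp: eventually_at_top_linorder)
  show thesis
  proof (rule that[of "max N T0"])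
    fix t assume t: "t \<ge> max N T0"
    then have "t > 0" using T0 by simp
    have "norm (A t - M t) = t powr (- b) * (t powr b * norm (A t - M t))"
      using \<open>t > 0\<close> by (simp flip: powr_add mult.assoc)
    also have "\<dots> \<le> t powr (- b) * \<epsilon>" using N[of t] t by (intro mult_left_mono) auto
    finally show "norm (A t - M t) \<le> \<epsilon> * t powr (- b)" by (simp add: mult.commute)
  qed simp
qed

lemma asymptotic_imp_tendsto:
  assumes "asymptotic A"
  shows "((\<lambda>t. A t - M t) \<longlongrightarrow> 0) at_top"
proof (rule Lim_null_comparison)
  show "((\<lambda>t. t powr b * norm (A t - M t)) \<longlongrightarrow> 0) at_top" using assms unfolding asymptotic_def .
  show "\<forall>\<^sub>F t in at_top. norm (A t - M t) \<le> t powr b * norm (A t - M t)"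
    using eventually_ge_at_top[of 1]
  proof eventually_elim
    case (elim t)
    then have "1 * norm (A t - M t) \<le> t powr b * norm (A t - M t)"
      using b by (intro mult_right_mono ge_one_powr_ge_zero) auto
    then show ?case by simp
  qed
qed

text \<open>
  An asymptotic solution is eventually close enough to the free motion for the bound on the
  force; the free motion has no acceleration, so integrating that bound twice from infinity
  gives the rates for the difference and its derivative.
\<close>
lemma asymptotic_solution_decay:
  assumes A: "\<And>t. (A has_vector_derivative A' t) (at t)"
      "\<And>t. (A' has_vector_derivative force \<gamma> (A t)) (at t)" "\<And>t. det (A t) > 0"
    and asym: "asymptotic A"
  shows "\<exists>T K. T > 0 \<and> (\<forall>t\<ge>T. norm (A t - M t) \<le> K * t powr (- \<mu>) \<and>
    norm (A' t - A1) \<le> K * t powr (- \<mu> - 1) \<and> norm (force \<gamma> (A t)) \<le> K * t powr (- \<mu> - 2))"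
proof -
  obtain \<epsilon> K where K: "\<epsilon> > 0" "K > 0"
    "\<And>t X. t \<ge> T0 \<Longrightarrow> norm X \<le> \<epsilon> * t powr (- b) \<Longrightarrow>
      det (M t + X) > 0 \<and> norm (force \<gamma> (M t + X)) \<le> K * t powr (- \<mu> - 2)"
    using force_near_free_motion by metis
  obtain T where T: "T \<ge> T0" "\<And>t. t \<ge> T \<Longrightarrow> norm (A t - M t) \<le> \<epsilon> * t powr (- b)"
    using asymptotic_imp_close[OF asym K(1)] by metis
  have mu0: "\<mu> > 0" using b by simp
  have Tpos: "t > 0" if "t \<ge> T" for t using that T T0 by simp
  have F: "norm (force \<gamma> (A t)) \<le> K * t powr (- \<mu> - 2)" if "t \<ge> T" for t
    using K(3)[of t "A t - M t"] T that by simp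
  have D: "((\<lambda>t. A t - M t) has_vector_derivative A' t - A1) (at t)" for t
    by (rule has_vector_derivative_diff[OF A(1) M_deriv])
  have D': "((\<lambda>t. A' t - A1) has_vector_derivative force \<gamma> (A t)) (at t)" for t
    using has_vector_derivative_diff[OF A(2)[of t] has_vector_derivative_const[of A1]] by simp
  have "continuous_on UNIV A"
    using A(1) by (auto intro!: continuous_at_imp_continuous_on has_vector_derivative_continuous)
  then have cF: "continuous_on UNIV (\<lambda>t. force \<gamma> (A t))"
    by (rule continuous_on_force) (use A(3) in \<open>simp add: less_imp_neq[symmetric]\<close>)
  note w = powr_weight(1,2)[OF mu0 Tpos, of _ K]
  note lims = powr_weight(3,4)[OF mu0, of K]
  have D0: "((\<lambda>t. A t - M t) \<longlongrightarrow> 0) at_top" by (rule asymptotic_imp_tendsto[OF asym])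
  have D'0: "((\<lambda>t. A' t - A1) \<longlongrightarrow> 0) at_top"
    by (rule deriv_tendsto_0_of_second_deriv_bound[OF D D' cF w F D0 lims])
  have 1: "norm (A' t - A1) \<le> K / (\<mu> + 1) * t powr (- \<mu> - 1)"
    "norm (A t - M t) \<le> K / (\<mu> * (\<mu> + 1)) * t powr (- \<mu>)" if "t \<ge> T" for t
    using norm_le_from_infinity2[where T=T, OF D D' w F D0 D'0 lims that] by simp_all
  define C where "C = max K (max (K / (\<mu> + 1)) (K / (\<mu> * (\<mu> + 1))))"
  have C: "K * t powr s \<le> C * t powr s" "K / (\<mu> + 1) * t powr s \<le> C * t powr s"
    "K / (\<mu> * (\<mu> + 1)) * t powr s \<le> C * t powr s" for t s
    by (intro mult_right_mono; simp add: C_def)+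
  have "norm (A t - M t) \<le> C * t powr (- \<mu>) \<and>
    norm (A' t - A1) \<le> C * t powr (- \<mu> - 1) \<and> norm (force \<gamma> (A t)) \<le> C * t powr (- \<mu> - 2)"
    if "t \<ge> T" for t
    using 1[OF that] F[OF that] C(1)[of t "- \<mu> - 2"] C(2)[of t "- \<mu> - 1"] C(3)[of t "- \<mu>"] by linarith
  then show ?thesis using T T0 by (intro exI[of _ T] exI[of _ C]) auto
qed

lemma asymptotic_solution_unique:
  assumes "global_solution \<gamma> A" "global_solution \<gamma> B" and asym: "asymptotic A" "asymptotic B"
  shows "A = B"
proof -
  obtain A' where A: "\<And>t. (A has_vector_derivative A' t) (at t)"
      "\<And>t. (A' has_vector_derivative force \<gamma> (A t)) (at t)" "\<And>t. det (A t) > 0"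
    using assms(1) unfolding global_solution_iff by blast
  obtain B' where B: "\<And>t. (B has_vector_derivative B' t) (at t)"
      "\<And>t. (B' has_vector_derivative force \<gamma> (B t)) (at t)" "\<And>t. det (B t) > 0"
    using assms(2) unfolding global_solution_iff by blast
  obtain \<epsilon> K where K: "\<epsilon> > 0"
    "\<And>t X Y. t \<ge> T0 \<Longrightarrow> norm X \<le> \<epsilon> * t powr (- b) \<Longrightarrow> norm Y \<le> \<epsilon> * t powr (- b) \<Longrightarrow>
      norm (force \<gamma> (M t + X) - force \<gamma> (M t + Y)) \<le> K * t powr (- (\<mu> - b) - 2) * norm (X - Y)"
    using force_near_free_motion by metis
  obtain TA where TA: "TA \<ge> T0" "\<And>t. t \<ge> TA \<Longrightarrow> norm (A t - M t) \<le> \<epsilon> * t powr (- b)"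
    using asymptotic_imp_close[OF asym(1) K(1)] by metis
  obtain TB where TB: "TB \<ge> T0" "\<And>t. t \<ge> TB \<Longrightarrow> norm (B t - M t) \<le> \<epsilon> * t powr (- b)"
    using asymptotic_imp_close[OF asym(2) K(1)] by metis
  show ?thesis
  proof (rule solutions_agree_if_asymptotic[OF _ _ _ A B, where T="max TA TB" and \<sigma>="\<mu> - b" and K=K])
    show "((\<lambda>t. A t - B t) \<longlongrightarrow> 0) at_top"
      using tendsto_diff[OF asymptotic_imp_tendsto[OF asym(1)] asymptotic_imp_tendsto[OF asym(2)]] by simp
    show "norm (force \<gamma> (A t) - force \<gamma> (B t)) \<le> K * t powr (- (\<mu> - b) - 2) * norm (A t - B t)"
      if "t \<ge> max TA TB" for t
      using K(2)[OF _ TA(2) TB(2), of t] that TA(1) by simp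
  qed (use gamma b TA T0 in auto)
qed

text \<open>
  The deviation u from the free motion M should satisfy u'' = force (M + u) and vanish at infinity.
  Clipping u at the radius where the force is controlled and freezing time before T0 makes the
  right-hand side globally Lipschitz, so u exists.  Its a priori decay t^(-\<mu>) beats the clipping
  radius of order t^(-b), so from some time on M + u solves the original equation; from there it
  is continued to the past.
\<close>
lemma asymptotic_solution_exists: "\<exists>A. global_solution \<gamma> A \<and> asymptotic A"
proof -
  obtain \<epsilon> K where K: "\<epsilon> > 0" "K > 0"
    "\<And>t X. t \<ge> T0 \<Longrightarrow> norm X \<le> \<epsilon> * t powr (- b) \<Longrightarrow>
      det (M t + X) > 0 \<and> norm (force \<gamma> (M t + X)) \<le> K * t powr (- \<mu> - 2)"
    "\<And>t X Y. t \<ge> T0 \<Longrightarrow> norm X \<le> \<epsilon> * t powr (- b) \<Longrightarrow> norm Y \<le> \<epsilon> * t powr (- b) \<Longrightarrow>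
      norm (force \<gamma> (M t + X) - force \<gamma> (M t + Y)) \<le> K * t powr (- (\<mu> - b) - 2) * norm (X - Y)"
    using force_near_free_motion by metis
  define \<sigma> where "\<sigma> = \<mu> - b"
  have \<sigma>: "\<sigma> > 0" and mu0: "\<mu> > 0" using b by (auto simp: \<sigma>_def)
  define \<tau> where "\<tau> t = max t T0" for t
  have \<tau>: "\<tau> t \<ge> T0" "\<tau> t > 0" for t using T0 by (auto simp: \<tau>_def)
  define \<rho> where "\<rho> t = \<epsilon> * \<tau> t powr (- b)" for t
  have \<rho>: "\<rho> t > 0" for t using K(1) \<tau>(2)[of t] by (simp add: \<rho>_def)
  define G where "G t x = force \<gamma> (M (\<tau> t) + clip (\<rho> t) x)" for t x
  define \<kappa> where "\<kappa> t = 2 * K * \<tau> t powr (- \<sigma> - 2)" for t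
  have in_ball: "norm (clip (\<rho> t) x) \<le> \<epsilon> * \<tau> t powr (- b)" for t and x :: "real^3^3"
    using norm_clip_le[OF \<rho>] by (simp add: \<rho>_def)
  have c\<tau>: "continuous_on s (\<lambda>x. \<tau> (g x))" if "continuous_on s g" for g :: "'z::topological_space \<Rightarrow> real" and s
    unfolding \<tau>_def by (intro continuous_intros that)
  have c\<rho>: "continuous_on s (\<lambda>x. \<rho> (g x))" if "continuous_on s g" for g :: "'z::topological_space \<Rightarrow> real" and s
    unfolding \<rho>_def by (intro continuous_intros c\<tau> that) (metis \<tau>(2) less_irrefl)
  have cG: "continuous_on UNIV (\<lambda>p. G (fst p) (snd p))"
    unfolding G_def
  proof (rule continuous_on_force)
    show "continuous_on UNIV (\<lambda>p. M (\<tau> (fst p)) + clip (\<rho> (fst p)) (snd p))"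
      unfolding A_infty_def
      by (intro continuous_on_add continuous_on_const continuous_on_scaleR continuous_on_clip c\<tau> c\<rho>
          continuous_on_fst continuous_on_snd continuous_on_id \<rho>)
    show "det (M (\<tau> (fst p)) + clip (\<rho> (fst p)) (snd p)) \<noteq> 0" for p
      using K(3)[OF \<tau>(1) in_ball[of "fst p" "snd p"]] by simp
  qed
  have c\<kappa>: "continuous_on UNIV \<kappa>"
    unfolding \<kappa>_def[abs_def] by (intro continuous_intros c\<tau>) (metis \<tau>(2) less_irrefl)
  have \<kappa>pos: "0 \<le> \<kappa> t" for t using K(2) by (simp add: \<kappa>_def)
  have \<kappa>dec: "\<kappa> t \<le> 2 * K * t powr (- \<sigma> - 2)" if "t \<ge> T0" for t using that by (simp add: \<kappa>_def \<tau>_def max_absorb1)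
  have Gle: "norm (G t x) \<le> K * \<tau> t powr (- \<mu> - 2)" for t x
    unfolding G_def using K(3)[OF \<tau>(1) in_ball] by blast
  have G0: "norm (G t 0) \<le> \<kappa> t" for t
  proof -
    have "\<tau> t powr (- \<mu> - 2) \<le> \<tau> t powr (- \<sigma> - 2)"
      using \<tau>(1)[of t] T0 b by (intro powr_mono) (auto simp: \<sigma>_def)
    then have "K * \<tau> t powr (- \<mu> - 2) \<le> K * \<tau> t powr (- \<sigma> - 2)"
      using K(2) by (intro mult_left_mono) auto
    also have "\<dots> \<le> \<kappa> t" using K(2) by (simp add: \<kappa>_def)
    finally show ?thesis using Gle[of t 0] by linarith
  qed
  have lip: "norm (G t x - G t y) \<le> \<kappa> t * norm (x - y)" for t x y
  proof -
    have "norm (G t x - G t y) \<le> K * \<tau> t powr (- \<sigma> - 2) * norm (clip (\<rho> t) x - clip (\<rho> t) y)"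
      unfolding G_def \<sigma>_def by (rule K(4)[OF \<tau>(1) in_ball in_ball])
    also have "\<dots> \<le> K * \<tau> t powr (- \<sigma> - 2) * (2 * norm (x - y))"
      using K(2) by (intro mult_left_mono clip_lipschitz \<rho>) auto
    finally show ?thesis by (simp add: \<kappa>_def mult_ac)
  qed
  have T0pos: "T0 > 0" using T0 by simp
  obtain u u' where u: "\<And>t. (u has_vector_derivative u' t) (at t)"
    "\<And>t. (u' has_vector_derivative G t (u t)) (at t)" "(u \<longlongrightarrow> 0) at_top"
    by (rule second_order_solution_from_infinity[OF c\<kappa> \<kappa>pos \<kappa>dec T0pos \<sigma> cG lip G0], assumption, rule that)
  have "continuous_on UNIV u"
    using u(1) by (auto intro!: continuous_at_imp_continuous_on has_vector_derivative_continuous)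
  then have cGu: "continuous_on UNIV (\<lambda>t. G t (u t))"
    using continuous_on_compose2[OF cG continuous_on_Pair[OF continuous_on_id]] by simp
  have Gu: "norm (G t (u t)) \<le> K * t powr (- \<mu> - 2)" if "t \<ge> T0" for t
    using Gle[of t "u t"] that by (simp add: \<tau>_def max_absorb1)
  have pos: "t > 0" if "t \<ge> T0" for t using that T0 by simp
  note w = powr_weight(1,2)[OF mu0 pos, of _ K]
  note lims = powr_weight(3,4)[OF mu0, of K]
  have u'0: "(u' \<longlongrightarrow> 0) at_top"
    by (rule deriv_tendsto_0_of_second_deriv_bound[OF u(1,2) cGu w Gu u(3) lims])
  define K2 where "K2 = K / (\<mu> * (\<mu> + 1))"
  have ule: "norm (u t) \<le> K2 * t powr (- \<mu>)" if "t \<ge> T0" for t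
    using norm_le_from_infinity2(2)[where T=T0, OF u(1,2) w Gu u(3) u'0 lims that] by (simp add: K2_def)
  have tb: "((\<lambda>t. t powr b * norm (u t)) \<longlongrightarrow> 0) at_top"
  proof (rule Lim_null_comparison)
    have "((\<lambda>t. t powr (b - \<mu>)) \<longlongrightarrow> 0) at_top"
      using b by (intro tendsto_neg_powr filterlim_ident) auto
    then show "((\<lambda>t. K2 * t powr (b - \<mu>)) \<longlongrightarrow> 0) at_top" by (rule tendsto_mult_right_zero)
    show "\<forall>\<^sub>F t in at_top. norm (t powr b * norm (u t)) \<le> K2 * t powr (b - \<mu>)"
      using eventually_ge_at_top[of T0]
    proof eventually_elim
      case (elim t)
      have "t powr b * norm (u t) \<le> t powr b * (K2 * t powr (- \<mu>))"
        by (intro mult_left_mono ule elim) auto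
      also have "\<dots> = K2 * t powr (b - \<mu>)" by (simp flip: powr_add)
      finally show ?case by simp
    qed
  qed
  then have "\<forall>\<^sub>F t in at_top. dist (t powr b * norm (u t)) 0 < \<epsilon>"
    using K(1) by (intro tendstoD)
  then obtain N where N: "\<And>t. t \<ge> N \<Longrightarrow> t powr b * norm (u t) < \<epsilon>"
    by (auto simp: eventually_at_top_linorder)
  define T where "T = max N T0"
  have close: "norm (u t) \<le> \<rho> t" if "t \<ge> T" for t
  proof -
    have t: "t > 0" "t \<ge> N" "\<tau> t = t" using that T0 by (auto simp: T_def \<tau>_def)
    have "norm (u t) = t powr (- b) * (t powr b * norm (u t))"
      using t by (simp flip: powr_add mult.assoc)
    also have "\<dots> \<le> t powr (- b) * \<epsilon>" using N[of t] t by (intro mult_left_mono) auto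
    finally show ?thesis using t by (simp add: \<rho>_def mult.commute)
  qed
  have sol: "det (M t + u t) > 0 \<and> G t (u t) = force \<gamma> (M t + u t)" if "t \<ge> T" for t
  proof -
    have "\<tau> t = t" using that by (simp add: T_def \<tau>_def)
    moreover have "clip (\<rho> t) (u t) = u t" by (rule clip_eq[OF \<rho> close[OF that]])
    ultimately show ?thesis
      using K(3)[OF \<tau>(1), of "u t" t] in_ball[of t "u t"] by (simp add: G_def)
  qed
  have S: "((\<lambda>t. M t + u t) has_vector_derivative A1 + u' t) (at t)" for t
    by (rule has_vector_derivative_add[OF M_deriv u(1)])
  have S': "((\<lambda>t. A1 + u' t) has_vector_derivative G t (u t)) (at t)" for t
    using has_vector_derivative_add[OF has_vector_derivative_const[of A1] u(2)[of t]] by simp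
  obtain A where A: "global_solution \<gamma> A" "\<And>t. t \<ge> T \<Longrightarrow> A t = M t + u t"
    by (rule extend_solution_to_past[OF gamma S S' cGu sol], assumption, rule that)
  have "\<forall>\<^sub>F t in at_top. t powr b * norm (u t) = t powr b * norm (A t - M t)"
    using eventually_ge_at_top[of T] by eventually_elim (simp add: A(2))
  then have "asymptotic A" unfolding asymptotic_def using tb by (rule Lim_transform_eventually[rotated])
  then show ?thesis using A(1) by blast
qed

end

section \<open>The theorem for the operator norm\<close>

lemma opnorm_tendsto_iff:
  assumes "\<forall>\<^sub>F t in F. f t \<ge> (0::real)"
  shows "((\<lambda>t. f t * opnorm (X t)) \<longlongrightarrow> 0) F \<longleftrightarrow> ((\<lambda>t. f t * norm (X t)) \<longlongrightarrow> 0) F"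
proof
  assume "((\<lambda>t. f t * opnorm (X t)) \<longlongrightarrow> 0) F"
  then have *: "((\<lambda>t. 9 * (f t * opnorm (X t))) \<longlongrightarrow> 0) F" by (rule tendsto_mult_right_zero)
  show "((\<lambda>t. f t * norm (X t)) \<longlongrightarrow> 0) F"
  proof (rule Lim_null_comparison[OF _ *])
    show "\<forall>\<^sub>F t in F. norm (f t * norm (X t)) \<le> 9 * (f t * opnorm (X t))"
      using assms
    proof eventually_elim
      case (elim t)
      then show ?case using mult_left_mono[OF norm_matrix_le_opnorm[of "X t"] elim] by simp
    qed
  qed
next
  assume "((\<lambda>t. f t * norm (X t)) \<longlongrightarrow> 0) F"
  then have *: "((\<lambda>t. 9 * (f t * norm (X t))) \<longlongrightarrow> 0) F" by (rule tendsto_mult_right_zero)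
  show "((\<lambda>t. f t * opnorm (X t)) \<longlongrightarrow> 0) F"
  proof (rule Lim_null_comparison[OF _ *])
    show "\<forall>\<^sub>F t in F. norm (f t * opnorm (X t)) \<le> 9 * (f t * norm (X t))"
      using assms
    proof eventually_elim
      case (elim t)
      then show ?case
        using mult_left_mono[OF opnorm_le_norm_matrix[of "X t"] elim] opnorm_nonneg[of "X t"] by simp
    qed
  qed
qed

text \<open>
  The quotient by the leading power tends to the leading coefficient, which is positive because
  the polynomial is eventually positive.
\<close>
lemma poly_ge_power_degree:
  fixes p :: "real poly"
  assumes "filterlim (poly p) at_top at_top"
  obtains c where "c > 0" "\<forall>\<^sub>F t in at_top. c * t ^ degree p \<le> poly p t"
proof -
  let ?d = "degree p"
  have summand: "((\<lambda>t. coeff p i * (t ^ i / t ^ ?d)) \<longlongrightarrow> (if i = ?d then lead_coeff p else 0)) at_top"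
    if "i \<le> ?d" for i
  proof (cases "i = ?d")
    case True
    have "\<forall>\<^sub>F t::real in at_top. lead_coeff p = coeff p i * (t ^ i / t ^ ?d)"
      using eventually_gt_at_top[of 0] by eventually_elim (simp add: True)
    from Lim_transform_eventually[OF tendsto_const this] show ?thesis using True by simp
  next
    case False
    then have i: "?d - i > 0" using that by simp
    have "((\<lambda>t::real. inverse (t ^ (?d - i))) \<longlongrightarrow> 0) at_top"
      by (intro tendsto_inverse_0_at_top filterlim_pow_at_top i filterlim_ident)
    then have "((\<lambda>t. coeff p i * inverse (t ^ (?d - i))) \<longlongrightarrow> 0) at_top"
      by (rule tendsto_mult_right_zero)
    moreover have "\<forall>\<^sub>F t::real in at_top. coeff p i * inverse (t ^ (?d - i)) = coeff p i * (t ^ i / t ^ ?d)"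
      using eventually_gt_at_top[of 0]
      by eventually_elim (use that in \<open>simp add: power_diff field_simps\<close>)
    ultimately show ?thesis using False by (simp add: Lim_transform_eventually)
  qed
  have "((\<lambda>t. \<Sum>i\<le>?d. coeff p i * (t ^ i / t ^ ?d)) \<longlongrightarrow> (\<Sum>i\<le>?d. if i = ?d then lead_coeff p else 0)) at_top"
    by (intro tendsto_sum summand) simp
  then have lim: "((\<lambda>t. poly p t / t ^ ?d) \<longlongrightarrow> lead_coeff p) at_top"
    by (simp add: poly_altdef sum_divide_distrib)
  have ev: "\<forall>\<^sub>F t in at_top. poly p t > 0 \<and> t > (0::real)"
    using assms unfolding filterlim_at_top_dense by (intro eventually_conj eventually_gt_at_top) auto
  have "p \<noteq> 0"
  proof
    assume "p = 0"
    with ev have "\<forall>\<^sub>F t in at_top. t > (0::real) \<and> False" by simp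
    then show False by (simp add: trivial_limit_at_top_linorder)
  qed
  moreover have "lead_coeff p \<ge> 0"
  proof (rule tendsto_lowerbound[OF lim])
    show "\<forall>\<^sub>F t in at_top. 0 \<le> poly p t / t ^ ?d" using ev by eventually_elim simp
  qed simp
  ultimately have lc: "lead_coeff p > 0" by (simp add: order_le_less)
  have "\<forall>\<^sub>F t in at_top. lead_coeff p / 2 < poly p t / t ^ ?d"
    using lc by (intro order_tendstoD(1)[OF lim]) simp
  then have "\<forall>\<^sub>F t in at_top. lead_coeff p / 2 * t ^ ?d \<le> poly p t"
    using ev by eventually_elim (simp add: field_simps)
  then show thesis using lc by (intro that[of "lead_coeff p / 2"]) auto
qed

text \<open>
  The predicate P stands for the convergence condition in the form in which each case of the
  theorem states it.
\<close>
lemma (in free_motion) existence_uniqueness_decay: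
  assumes P: "\<And>A. P A \<longleftrightarrow> asymptotic A"
  shows "(\<exists>!A. global_solution \<gamma> A \<and> P A) \<and>
    (\<forall>A. global_solution \<gamma> A \<and> P A \<longrightarrow>
      (\<forall>k\<in>{0, 1, 2}. (\<lambda>t. opnorm (nth_vderiv k A t - nth_vderiv k M t))
        \<in> O[at_top](\<lambda>t. t powr (- \<mu> - real k))))"
proof (intro conjI allI impI)
  show "\<exists>!A. global_solution \<gamma> A \<and> P A"
    using asymptotic_solution_exists asymptotic_solution_unique unfolding P by blast
next
  fix A assume "global_solution \<gamma> A \<and> P A"
  then have gs: "global_solution \<gamma> A" and asym: "asymptotic A" unfolding P by auto
  obtain A' where A: "\<And>t. (A has_vector_derivative A' t) (at t)"
      "\<And>t. (A' has_vector_derivative force \<gamma> (A t)) (at t)" "\<And>t. det (A t) > 0"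
    using gs unfolding global_solution_iff by blast
  obtain T K where T: "T > 0" "\<And>t. t \<ge> T \<Longrightarrow> norm (A t - M t) \<le> K * t powr (- \<mu>) \<and>
    norm (A' t - A1) \<le> K * t powr (- \<mu> - 1) \<and> norm (force \<gamma> (A t)) \<le> K * t powr (- \<mu> - 2)"
    using asymptotic_solution_decay[OF A asym] by blast
  have bigo: "(\<lambda>t. opnorm (X t)) \<in> O[at_top](\<lambda>t. t powr s)"
    if "\<And>t. t \<ge> T \<Longrightarrow> norm (X t) \<le> K * t powr s" for X s
  proof (rule bigoI[of _ "9 * K"])
    show "\<forall>\<^sub>F t in at_top. norm (opnorm (X t)) \<le> 9 * K * norm (t powr s)"
      using eventually_ge_at_top[of T]
    proof eventually_elim
      case (elim t)
      then show ?case
        using that[of t] opnorm_le_norm_matrix[of "X t"] opnorm_nonneg[of "X t"] by simp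
    qed
  qed
  note dA = nth_vderiv_simps[OF A(1,2)] and dM = nth_vderiv_simps[OF M_deriv has_vector_derivative_const]
  show "\<forall>k\<in>{0, 1, 2}. (\<lambda>t. opnorm (nth_vderiv k A t - nth_vderiv k M t))
      \<in> O[at_top](\<lambda>t. t powr (- \<mu> - real k))"
  proof (intro ballI)
    fix k :: nat assume "k \<in> {0, 1, 2}"
    then consider "k = 0" | "k = 1" | "k = 2" by auto
    then show "(\<lambda>t. opnorm (nth_vderiv k A t - nth_vderiv k M t)) \<in> O[at_top](\<lambda>t. t powr (- \<mu> - real k))"
    proof cases
      case 1
      show ?thesis unfolding 1 dA dM by (rule bigo) (use T(2) in simp)
    next
      case 2
      show ?thesis unfolding 2 dA dM by (rule bigo) (use T(2) in simp)
    next
      case 3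
      show ?thesis unfolding 3 dA dM by (rule bigo) (use T(2) in simp)
    qed
  qed
qed

theorem theorem5:
  fixes \<gamma> \<mu> :: real and A0 A1 :: "real^3^3" and p :: "real poly" and d :: nat and a :: int
  assumes gamma: "\<gamma> > 1"
    and det_lim: "filterlim (\<lambda>t. det (A_infty A0 A1 t)) at_top at_top"
    and p: "\<And>t. poly p t = det (A_infty A0 A1 t)"
    and d: "d = degree p" "d \<in> {1, 2, 3}"
    and a: "a \<in> {-1, 0, 1}"
      "(\<lambda>t. opnorm (matrix_inv (A_infty A0 A1 t))) \<in> \<Theta>[at_top](\<lambda>t::real. t powi a)"
    and mu: "\<mu> = real d * (\<gamma> - 1) - real_of_int a - 2"
  shows
    "(a \<noteq> 1 \<and> \<mu> > 0 \<longrightarrow>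
       (\<exists>!A. global_solution \<gamma> A \<and>
          ((\<lambda>t. opnorm (A t - A_infty A0 A1 t)) \<longlongrightarrow> 0) at_top) \<and>
       (\<forall>A. global_solution \<gamma> A \<and>
          ((\<lambda>t. opnorm (A t - A_infty A0 A1 t)) \<longlongrightarrow> 0) at_top \<longrightarrow>
          (\<forall>k\<in>{0, 1, 2}.
             (\<lambda>t. opnorm (nth_vderiv k A t - nth_vderiv k (A_infty A0 A1) t))
               \<in> O[at_top](\<lambda>t. t powr (- \<mu> - real k)))))
     \<and>
     (a = 1 \<and> d = 1 \<and> \<gamma> > 5 \<longrightarrow>
       (\<exists>!A. global_solution \<gamma> A \<and>
          ((\<lambda>t. t * opnorm (A t - A_infty A0 A1 t)) \<longlongrightarrow> 0) at_top) \<and>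
       (\<forall>A. global_solution \<gamma> A \<and>
          ((\<lambda>t. t * opnorm (A t - A_infty A0 A1 t)) \<longlongrightarrow> 0) at_top \<longrightarrow>
          (\<forall>k\<in>{0, 1, 2}.
             (\<lambda>t. opnorm (nth_vderiv k A t - nth_vderiv k (A_infty A0 A1) t))
               \<in> O[at_top](\<lambda>t. t powr (4 - \<gamma> - real k)))))"
proof -
  obtain c where c: "c > 0" "\<forall>\<^sub>F t in at_top. c * t ^ d \<le> det (A_infty A0 A1 t)"
  proof -
    have "poly p = (\<lambda>t. det (A_infty A0 A1 t))" using p by (rule ext)
    then show thesis using poly_ge_power_degree[of p] det_lim that d(1) by auto
  qed
  obtain C where C: "C > 0" "\<forall>\<^sub>F t in at_top.
      norm (opnorm (matrix_inv (A_infty A0 A1 t))) \<le> C * norm (t powi a)"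
    using landau_o.bigE[OF bigthetaD1[OF a(2)]] by blast
  have "\<forall>\<^sub>F t in at_top. c * t powr real d \<le> det (A_infty A0 A1 t) \<and>
      norm (matrix_inv (A_infty A0 A1 t)) \<le> (9 * C) * t powr real_of_int a"
    using c(2) C(2) eventually_gt_at_top[of 0]
  proof eventually_elim
    case (elim t)
    have "norm (matrix_inv (A_infty A0 A1 t)) \<le> 9 * (C * t powi a)"
      using norm_matrix_le_opnorm[of "matrix_inv (A_infty A0 A1 t)"] elim by simp
    then show ?case using elim by (simp add: powr_realpow powr_real_of_int')
  qed
  then obtain T where T: "\<And>t. t \<ge> T \<Longrightarrow> c * t powr real d \<le> det (A_infty A0 A1 t) \<and>
      norm (matrix_inv (A_infty A0 A1 t)) \<le> (9 * C) * t powr real_of_int a"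
    unfolding eventually_at_top_linorder by blast
  have motion: "free_motion \<gamma> (real d) (real_of_int a) b \<mu> (max T 1) c (9 * C) A0 A1"
    if "b \<ge> real_of_int a" "b \<ge> 0" "\<mu> > b" for b
    using that gamma c(1) C(1) T mu by unfold_locales auto
  show ?thesis
  proof (intro conjI[of "a \<noteq> 1 \<and> \<mu> > 0 \<longrightarrow> _"] impI)
    assume i: "a \<noteq> 1 \<and> \<mu> > 0"
    then interpret free_motion \<gamma> "real d" "real_of_int a" 0 \<mu> "max T 1" c "9 * C" A0 A1
      using a(1) by (intro motion) auto
    have "((\<lambda>t. opnorm (A t - A_infty A0 A1 t)) \<longlongrightarrow> 0) at_top \<longleftrightarrow> asymptotic A" for A
    proof -
      have "asymptotic A \<longleftrightarrow> ((\<lambda>t. t powr 0 * opnorm (A t - A_infty A0 A1 t)) \<longlongrightarrow> 0) at_top"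
        unfolding asymptotic_def by (rule opnorm_tendsto_iff[symmetric]) simp
      also have "\<dots> \<longleftrightarrow> ((\<lambda>t. opnorm (A t - A_infty A0 A1 t)) \<longlongrightarrow> 0) at_top"
        by (rule tendsto_cong) (use eventually_gt_at_top[of 0] in \<open>eventually_elim, simp\<close>)
      finally show ?thesis by simp
    qed
    then show "(\<exists>!A. global_solution \<gamma> A \<and>
          ((\<lambda>t. opnorm (A t - A_infty A0 A1 t)) \<longlongrightarrow> 0) at_top) \<and>
       (\<forall>A. global_solution \<gamma> A \<and>
          ((\<lambda>t. opnorm (A t - A_infty A0 A1 t)) \<longlongrightarrow> 0) at_top \<longrightarrow>
          (\<forall>k\<in>{0, 1, 2}.
             (\<lambda>t. opnorm (nth_vderiv k A t - nth_vderiv k (A_infty A0 A1) t))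
               \<in> O[at_top](\<lambda>t. t powr (- \<mu> - real k))))"
      by (rule existence_uniqueness_decay)
  next
    assume ii: "a = 1 \<and> d = 1 \<and> \<gamma> > 5"
    \<comment> \<open>With a = d = 1 the general exponent is \<mu> = \<gamma> - 4, so \<gamma> > 5 says \<mu> > b for b = 1.\<close>
    then have m: "4 - \<gamma> = - \<mu>" by (simp add: mu)
    interpret free_motion \<gamma> "real d" "real_of_int a" 1 \<mu> "max T 1" c "9 * C" A0 A1
      using ii by (intro motion) (auto simp: mu)
    have "((\<lambda>t. t * opnorm (A t - A_infty A0 A1 t)) \<longlongrightarrow> 0) at_top \<longleftrightarrow> asymptotic A" for A
    proof -
      have "asymptotic A \<longleftrightarrow> ((\<lambda>t. t powr 1 * opnorm (A t - A_infty A0 A1 t)) \<longlongrightarrow> 0) at_top"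
        unfolding asymptotic_def by (rule opnorm_tendsto_iff[symmetric]) simp
      also have "\<dots> \<longleftrightarrow> ((\<lambda>t. t * opnorm (A t - A_infty A0 A1 t)) \<longlongrightarrow> 0) at_top"
        by (rule tendsto_cong) (use eventually_gt_at_top[of 0] in \<open>eventually_elim, simp\<close>)
      finally show ?thesis by simp
    qed
    then show "(\<exists>!A. global_solution \<gamma> A \<and>
          ((\<lambda>t. t * opnorm (A t - A_infty A0 A1 t)) \<longlongrightarrow> 0) at_top) \<and>
       (\<forall>A. global_solution \<gamma> A \<and>
          ((\<lambda>t. t * opnorm (A t - A_infty A0 A1 t)) \<longlongrightarrow> 0) at_top \<longrightarrow>
          (\<forall>k\<in>{0, 1, 2}.
             (\<lambda>t. opnorm (nth_vderiv k A t - nth_vderiv k (A_infty A0 A1) t))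
               \<in> O[at_top](\<lambda>t. t powr (4 - \<gamma> - real k))))"
      unfolding m by (rule existence_uniqueness_decay)
  qed
qed

end
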